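(* Every continuous action by isometries of $\mathrm{SL}_3(\mathbb{R})$ on a uniformly convex Banach space has a fixed point.
   Context: A Banach space $E$ (over $\mathbb{R}$) is uniformly convex if for every $\varepsilon\in(0,2]$ there is $\delta>0$ such that for all unit vectors $\xi,\eta$ with $\|\xi-\eta\|\ge\varepsilon$ one has $\|(\xi+\eta)/2\|\le 1-\delta$. *)

theory Defs
  imports "HOL-Analysis.Analysis"
begin

definition SL3 :: "(real^3^3) set" where
  "SL3 = {A. det A = 1}"

definition uniformly_convex :: "'a::real_normed_vector itself \<Rightarrow> bool" where
  "uniformly_convex _ \<longleftrightarrow>
     (\<forall>\<epsilon>::real. 0 < \<epsilon> \<and> \<epsilon> \<le> 2 \<longrightarrow>
        (\<exists>\<delta>>0. \<forall>\<xi> \<eta>::'a. norm \<xi> = 1 \<and> norm \<eta> = 1 \<and> norm (\<xi> - \<eta>) \<ge> \<epsilon> \<longrightarrow>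
                   norm (scaleR (1/2) (\<xi> + \<eta>)) \<le> 1 - \<delta>))"

definition continuous_isometric_SL3_action :: "(real^3^3 \<Rightarrow> 'a::metric_space \<Rightarrow> 'a) \<Rightarrow> bool" where
  "continuous_isometric_SL3_action \<alpha> \<longleftrightarrow>
     (\<forall>x. \<alpha> (mat 1) x = x) \<and>
     (\<forall>A\<in>SL3. \<forall>B\<in>SL3. \<forall>x. \<alpha> (A ** B) x = \<alpha> A (\<alpha> B x)) \<and>
     (\<forall>A\<in>SL3. \<forall>x y. dist (\<alpha> A x) (\<alpha> A y) = dist x y) \<and>
     continuous_on (SL3 \<times> UNIV) (\<lambda>(A, x). \<alpha> A x)"

end

theory Submission
  imports Defs "HOL-Library.Multiset" "HOL-Real_Asymp.Real_Asymp"
begin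

text \<open>
  Isometries of a uniformly convex space are affine. For a one-parameter group \<open>u\<close> the operators
  \<open>p \<mapsto> (p + u s p) / 2\<close> are composed over dyadic scales \<open>s\<close> to averaging operators.
  Let \<open>x\<close>, \<open>y\<close> generate a Heisenberg group with center \<open>z\<close>. If averaging a displacement vector
  \<open>w = z c q - q\<close> over \<open>x s\<close> and \<open>y t\<close> with \<open>s * t = c\<close> hardly shortens it, then by uniform convexity
  \<open>w\<close> is nearly invariant under both, hence under the commutator \<open>z c\<close>, and then
  \<open>z (2 * c) q - q\<close> is much longer than \<open>w\<close>. Iterating this over many pairs of scales shows that
  averaging over \<open>y\<close> and then over \<open>x\<close> up to scale \<open>2 ^ (4 * a)\<close> makes any point almost invariant
  under the whole Heisenberg group, with an error \<open>O(a ^ -3)\<close> relative to the displacements of that point.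

  The six root subgroups of \<open>SL3\<close> form a hexagon 12, 13, 23, 21, 31, 32, in which each root is the
  commutator of its two neighbours. Averaging over 31, then 23, gives a point \<open>f\<close> almost invariant
  under 23, 31; therefore averaging \<open>f\<close> over 12 has almost the same effect as averaging it over 23 and 12, or over
  31 and 12, and yields a point almost invariant under all six. As root subgroups are
  exponentially distorted, the displacements up to scale \<open>2 ^ (16 * b)\<close> are \<open>O(b ^ 2)\<close>, which the
  error \<open>O(b ^ -3)\<close> beats. So the maximal displacement is halved by a move of proportional length, and
  iterating converges to a fixed point.
\<close>

section \<open>Affine isometries and averaging operators\<close>

text \<open>Dividing by the common norm reduces to unit vectors. In this homogeneous form one
  \<open>\<delta>\<close> serves displacement vectors of every length.\<close>

lemma uniformly_convex_scaled:
  assumes "uniformly_convex TYPE('a::real_normed_vector)" "0 < \<epsilon>" "\<epsilon> \<le> 2"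
  obtains \<delta> where "\<delta> > 0"
    "\<And>a b::'a. norm a = norm b \<Longrightarrow> \<epsilon> * norm a \<le> norm (a - b) \<Longrightarrow>
       norm (midpoint a b) \<le> (1 - \<delta>) * norm a"
proof -
  obtain \<delta> where \<delta>: "\<delta> > 0" "\<And>\<xi> \<eta>::'a. norm \<xi> = 1 \<Longrightarrow> norm \<eta> = 1 \<Longrightarrow> norm (\<xi> - \<eta>) \<ge> \<epsilon>
      \<Longrightarrow> norm (scaleR (1/2) (\<xi> + \<eta>)) \<le> 1 - \<delta>"
    using assms(1)[unfolded uniformly_convex_def, rule_format, OF conjI, OF assms(2,3)] by blast
  show thesis
  proof (rule that[OF \<delta>(1)])
    fix a b :: 'a
    assume ab: "norm a = norm b" "\<epsilon> * norm a \<le> norm (a - b)"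
    show "norm (midpoint a b) \<le> (1 - \<delta>) * norm a"
    proof (cases "norm a = 0")
      case True
      then show ?thesis using ab by (simp add: midpoint_def)
    next
      case False
      define r where "r = norm a"
      have r: "r > 0" using False by (simp add: r_def)
      have eq: "a /\<^sub>R r - b /\<^sub>R r = (a - b) /\<^sub>R r"
        by (simp add: scaleR_diff_right)
      have "norm (scaleR (1/2) (a /\<^sub>R r + b /\<^sub>R r)) \<le> 1 - \<delta>"
      proof (rule \<delta>(2))
        show "norm (a /\<^sub>R r) = 1" "norm (b /\<^sub>R r) = 1" using r ab by (simp_all add: r_def)
        show "\<epsilon> \<le> norm (a /\<^sub>R r - b /\<^sub>R r)"
          unfolding eq using r ab(2) unfolding r_def by (simp add: pos_le_divide_eq divide_inverse_commute[symmetric])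
      qed
      also have "scaleR (1/2) (a /\<^sub>R r + b /\<^sub>R r) = midpoint a b /\<^sub>R r"
        by (simp add: midpoint_def scaleR_add_right algebra_simps)
      finally have "norm (midpoint a b) / r \<le> 1 - \<delta>" using r by (simp add: divide_inverse_commute)
      then show ?thesis using r unfolding r_def by (simp add: pos_divide_le_eq)
    qed
  qed
qed

text \<open>Additivity of the linear part \<open>L\<close> already makes it respect midpoints, the
  only affine operation from which the averaging operators are built.\<close>

definition affine_isometry :: "('a::real_normed_vector \<Rightarrow> 'a) \<Rightarrow> bool" where
  "affine_isometry T \<longleftrightarrow> (\<exists>L. (\<forall>a b. L (a + b) = L a + L b) \<and> (\<forall>v. norm (L v) = norm v) \<and>
     (\<forall>p q. T p - T q = L (p - q)))"

lemma additive_diff_half: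
  fixes L :: "'a::real_normed_vector \<Rightarrow> 'a"
  assumes add: "\<forall>a b. L (a + b) = L a + L b"
  shows "L (a - b) = L a - L b" "L (midpoint a b) = midpoint (L a) (L b)"
proof -
  show "L (a - b) = L a - L b"
    using add by (metis add_diff_cancel diff_add_cancel)
  have "midpoint a b + midpoint a b = a + b"
    by (simp add: midpoint_def flip: scaleR_left.add)
  then have "L (midpoint a b) + L (midpoint a b) = L a + L b"
    using add by metis
  then have "midpoint (L a) (L b) = L (midpoint a b)" by (simp only: midpoint_eq_iff)
  then show "L (midpoint a b) = midpoint (L a) (L b)" ..
qed

lemma affine_isometry_dist: "affine_isometry T \<Longrightarrow> norm (T p - T q) = norm (p - q)"
  unfolding affine_isometry_def by metis

lemma affine_isometry_midpoint:
  assumes "affine_isometry T" shows "T (midpoint p q) = midpoint (T p) (T q)"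
proof -
  obtain L where L: "\<forall>a b. L (a + b) = L a + L b" "\<forall>p q. T p - T q = L (p - q)"
    using assms unfolding affine_isometry_def by blast
  have T: "T v = T 0 + L v" for v using L(2)[rule_format, of v 0] by (simp add: algebra_simps)
  show ?thesis
    by (subst (1 2 3) T, unfold additive_diff_half(2)[OF L(1)])
      (simp add: midpoint_def algebra_simps flip: scaleR_left.add)
qed

text \<open>In a strictly convex space the midpoint is characterised metrically, so no surjectivity is
  needed here, unlike in the Mazur--Ulam theorem.\<close>
lemma isometry_imp_affine_isometry:
  fixes T :: "'a::real_normed_vector \<Rightarrow> 'a"
  assumes uc: "uniformly_convex TYPE('a)" and iso: "\<And>x y. dist (T x) (T y) = dist x y"
  shows "affine_isometry T"
proof -
  have mid: "T (midpoint p q) = midpoint (T p) (T q)" for p q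
  proof (rule ccontr)
    assume ne: "T (midpoint p q) \<noteq> midpoint (T p) (T q)"
    \<comment> \<open>The image of the midpoint splits \<open>T q - T p\<close> into two vectors of
      equal length. If they differ, uniform convexity makes half of their sum shorter than
      \<open>dist p q / 2\<close>, although it is half of \<open>T q - T p\<close>.\<close>
    define a b where "a = T (midpoint p q) - T p" and "b = T q - T (midpoint p q)"
    have na: "norm a = dist p q / 2"
      unfolding a_def using iso[of "midpoint p q" p] by (simp add: dist_norm[symmetric] dist_midpoint)
    have nb: "norm b = dist p q / 2"
      unfolding b_def using iso[of q "midpoint p q"] by (simp add: dist_norm[symmetric] dist_midpoint)
    have ab: "a \<noteq> b"
    proof
      assume "a = b"
      then have "T p + T q = T (midpoint p q) + T (midpoint p q)"
        unfolding a_def b_def by (simp add: algebra_simps)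
      then have "midpoint (T p) (T q) = T (midpoint p q)" by (simp only: midpoint_eq_iff)
      then show False using ne by simp
    qed
    have r: "norm a > 0" using ab na nb by auto
    define \<epsilon> where "\<epsilon> = min 2 (norm (a - b) / norm a)"
    have "0 < \<epsilon>" "\<epsilon> \<le> 2" using ab r by (auto simp: \<epsilon>_def)
    then obtain \<delta> where \<delta>: "\<delta> > 0" "\<And>a b::'a. norm a = norm b \<Longrightarrow> \<epsilon> * norm a \<le> norm (a - b) \<Longrightarrow>
       norm (midpoint a b) \<le> (1 - \<delta>) * norm a"
      using uniformly_convex_scaled[OF uc] by metis
    have "\<epsilon> * norm a \<le> norm (a - b)"
      using r by (simp add: \<epsilon>_def min_def field_simps)
    then have "norm (midpoint a b) \<le> (1 - \<delta>) * norm a"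
      by (intro \<delta>(2)) (simp_all only: na nb)
    also have "\<dots> < norm a" using r \<delta>(1) by (simp add: algebra_simps)
    finally have "norm (midpoint a b) < dist p q / 2" using na by simp
    moreover have "midpoint a b = (1/2) *\<^sub>R (T q - T p)"
      by (simp add: midpoint_def a_def b_def)
    ultimately show False using iso[of q p] by (simp add: dist_norm norm_minus_commute)
  qed
  define L where "L v = T v - T 0" for v
  have Lmid: "L (midpoint p q) = midpoint (L p) (L q)" for p q
    unfolding L_def mid by (simp add: midpoint_def algebra_simps flip: scaleR_left.add)
  have L0: "L 0 = 0" by (simp add: L_def)
  have half: "L ((1/2) *\<^sub>R v) = (1/2) *\<^sub>R L v" for v
    using Lmid[of v 0] L0 by (simp add: midpoint_def)
  have add: "L (a + b) = L a + L b" for a b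
  proof -
    have "(1/2) *\<^sub>R L (a + b) = (1/2) *\<^sub>R (L a + L b)"
      using Lmid[of a b] half[of "a + b"] by (simp add: midpoint_def)
    then show ?thesis by simp
  qed
  have "T p - T q = L (p - q)" for p q
    using additive_diff_half(1)[of L p q] add by (simp add: L_def)
  moreover have "norm (L v) = norm v" for v
    using iso[of v 0] by (simp add: L_def dist_norm)
  ultimately show ?thesis unfolding affine_isometry_def using add by metis
qed

section \<open>One-parameter groups of affine isometries\<close>

definition affine_flow :: "(real \<Rightarrow> 'a::real_normed_vector \<Rightarrow> 'a) \<Rightarrow> bool" where
  "affine_flow u \<longleftrightarrow> (\<forall>s. affine_isometry (u s)) \<and> (\<forall>p. u 0 p = p) \<and>
     (\<forall>s t p. u (s + t) p = u s (u t p)) \<and> (\<forall>p. isCont (\<lambda>s. u s p) 0)"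

lemma affine_flowD:
  assumes "affine_flow u"
  shows "affine_isometry (u s)" "u 0 p = p" "u s (u t p) = u (s + t) p"
    "norm (u s p - u s q) = norm (p - q)" "u s (midpoint p q) = midpoint (u s p) (u s q)"
proof -
  show i: "affine_isometry (u s)" and "u 0 p = p" "u s (u t p) = u (s + t) p"
    using assms unfolding affine_flow_def by auto
  show "norm (u s p - u s q) = norm (p - q)" by (rule affine_isometry_dist[OF i])
  show "u s (midpoint p q) = midpoint (u s p) (u s q)" by (rule affine_isometry_midpoint[OF i])
qed

lemma affine_flow_small:
  assumes "affine_flow u" "\<eta> > 0"
  obtains r0 where "r0 > 0" "\<And>r. \<bar>r\<bar> \<le> r0 \<Longrightarrow> norm (u r p - p) \<le> \<eta>"
proof -
  have "isCont (\<lambda>s. u s p) 0" "u 0 p = p" using assms by (auto simp: affine_flow_def)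
  then obtain d where d: "d > 0" "\<And>r. \<bar>r\<bar> < d \<Longrightarrow> dist (u r p) p < \<eta>"
    using assms(2) unfolding continuous_at_eps_delta by (auto simp: dist_real_def)
  show thesis
    by (rule that[of "d/2"]) (use d in \<open>auto simp: dist_norm intro!: less_imp_le\<close>)
qed

lemma norm_midpoint_diff_le:
  fixes a b :: "'a::real_normed_vector"
  assumes "norm (a - c) \<le> e" "norm (b - d) \<le> e"
  shows "norm (midpoint a b - midpoint c d) \<le> e"
proof -
  have "midpoint a b - midpoint c d = (1/2) *\<^sub>R ((a - c) + (b - d))"
    by (simp add: midpoint_def algebra_simps)
  moreover have "norm ((a - c) + (b - d)) \<le> 2 * e" using assms norm_triangle_ineq[of "a - c" "b - d"] by linarith
  ultimately show ?thesis by simp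
qed

section \<open>Averaging operators over lists of scales\<close>

definition half_step :: "(real \<Rightarrow> 'a::real_normed_vector \<Rightarrow> 'a) \<Rightarrow> real \<Rightarrow> 'a \<Rightarrow> 'a" where
  "half_step u s q = midpoint q (u s q)"

text \<open>The last scale of the list acts first. For the scales \<open>\<tau> * 2 ^ i\<close> with
  \<open>i < n\<close>, expanding the product gives the uniform average of \<open>u\<close> over the
  times \<open>k * \<tau>\<close> with \<open>k < 2 ^ n\<close>.\<close>

definition averaging :: "(real \<Rightarrow> 'a::real_normed_vector \<Rightarrow> 'a) \<Rightarrow> real list \<Rightarrow> 'a \<Rightarrow> 'a" where
  "averaging u ss = foldr (half_step u) ss"

lemma averaging_simps [simp]:
  "averaging u [] q = q"
  "averaging u (s # ss) q = half_step u s (averaging u ss q)"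
  "averaging u (ss @ ts) q = averaging u ss (averaging u ts q)"
  by (simp_all add: averaging_def)

lemma half_step_nonexp:
  assumes "affine_flow u" shows "norm (half_step u s p - half_step u s q) \<le> norm (p - q)"
  unfolding half_step_def using affine_flowD(4)[OF assms] by (intro norm_midpoint_diff_le) auto

lemma averaging_nonexp:
  assumes "affine_flow u" shows "norm (averaging u ss p - averaging u ss q) \<le> norm (p - q)"
proof (induction ss)
  case (Cons s ss)
  show ?case using order_trans[OF half_step_nonexp[OF assms] Cons] by simp
qed simp

lemma midpoint_midpoint_swap:
  "midpoint (midpoint a b) (midpoint c d) = midpoint (midpoint a c) (midpoint b d)"
  unfolding midpoint_def by (simp add: scaleR_add_right)

lemma averaging_midpoint:
  assumes "affine_flow u"
  shows "averaging u ss (midpoint p q) = midpoint (averaging u ss p) (averaging u ss q)"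
proof (induction ss)
  case (Cons s ss)
  then show ?case
    by (simp add: half_step_def affine_flowD(5)[OF assms] midpoint_midpoint_swap[of "averaging u ss p"])
qed simp

lemma averaging_commute:
  assumes "affine_isometry T" "\<And>s q. T (u s q) = u s (T q)"
  shows "T (averaging u ss q) = averaging u ss (T q)"
  by (induction ss) (auto simp: half_step_def affine_isometry_midpoint[OF assms(1)] assms(2))

lemma averaging_flow:
  assumes "affine_flow u"
  shows "u s (averaging u ss q) = averaging u ss (u s q)"
  by (rule averaging_commute) (auto simp: affine_flowD[OF assms] add.commute)

lemma averaging_half_step_commute:
  assumes "affine_flow v" "\<And>s t q. u t (v s q) = v s (u t q)" "affine_flow u"
  shows "half_step u t (averaging v ss q) = averaging v ss (half_step u t q)"
  unfolding half_step_def averaging_midpoint[OF assms(1)]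
  by (subst averaging_commute) (auto simp: affine_flowD[OF assms(3)] assms(2))

text \<open>Half steps of one flow commute, since the flow is abelian and acts affinely, so the
  order of the scales is irrelevant.\<close>

lemma averaging_mset:
  assumes "affine_flow u" "mset ss = mset ts"
  shows "averaging u ss = averaging u ts"
proof
  fix q
  have c: "half_step u s \<circ> half_step u t = half_step u t \<circ> half_step u s" for s t
    using averaging_half_step_commute[OF assms(1) _ assms(1), of s "[t]"]
    by (auto simp: fun_eq_iff affine_flowD[OF assms(1)] add.commute)
  have "fold (half_step u) (rev ss) = fold (half_step u) (rev ts)"
    by (rule fold_multiset_equiv) (use c assms(2) in auto)
  then show "averaging u ss q = averaging u ts q" by (simp add: averaging_def foldr_conv_fold)
qed

text \<open>Selected scales can be moved to either end of the product. The remaining factors can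
  then be discarded from estimates, being nonexpansive.\<close>

lemma averaging_sublist:
  assumes "affine_flow u" "distinct ts" "set ts \<subseteq> set ss"
  obtains rest where "averaging u ss = averaging u (rest @ ts)" "averaging u ss = averaging u (ts @ rest)"
proof -
  have "mset ts \<subseteq># mset ss"
  proof (rule mset_subset_eqI)
    fix a
    show "count (mset ts) a \<le> count (mset ss) a"
    proof (cases "a \<in> set ts")
      case True
      then have "a \<in># mset ss" using assms(3) by auto
      then have "1 \<le> count (mset ss) a" by (simp only: count_greater_eq_one_iff)
      moreover have "count (mset ts) a \<le> 1"
        using assms(2) True distinct_count_atmost_1[of ts] by auto
      ultimately show ?thesis by (rule order_trans[rotated])
    next
      case False
      then have "a \<notin># mset ts" by simp
      then have "count (mset ts) a = 0" by (simp only: not_in_iff)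
      then show ?thesis by (simp only: le0)
    qed
  qed
  then obtain M where "mset ss = mset ts + M" by (metis subset_mset.less_eqE)
  moreover obtain rest where "M = mset rest" by (metis ex_mset)
  ultimately have "mset ss = mset (rest @ ts)" "mset ss = mset (ts @ rest)" by auto
  then show thesis using that averaging_mset[OF assms(1)] by metis
qed

text \<open>The reason is that an averaging operator is a convex combination of the maps \<open>u s\<close> with
  \<open>0 \<le> s \<le> sum_list ss\<close>.\<close>
lemma averaging_relation:
  assumes u: "affine_flow u" and v: "affine_flow v"
    and R: "\<And>a b c d. R a b \<Longrightarrow> R c d \<Longrightarrow> R (midpoint a c) (midpoint b d)"
    and nn: "\<And>s. s \<in> set ss \<Longrightarrow> s \<ge> 0"
    and base: "\<And>s. 0 \<le> s \<Longrightarrow> s \<le> sum_list ss \<Longrightarrow> R (u s p) (v s q)"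
  shows "R (averaging u ss p) (averaging v ss q)"
  using nn base
proof (induction ss arbitrary: p q)
  case Nil
  from Nil(2)[of 0] show ?case by (simp add: affine_flowD[OF u] affine_flowD[OF v])
next
  case (Cons s ss)
  have s: "s \<ge> 0" using Cons.prems by auto
  have "R (averaging u ss p) (averaging v ss q)"
  proof (rule Cons.IH)
    fix r assume "0 \<le> r" "r \<le> sum_list ss"
    then show "R (u r p) (v r q)" using Cons.prems(2)[of r] s by auto
  qed (use Cons.prems in auto)
  \<comment> \<open>The second half of the half step is the same average started at
    \<open>u s p\<close>, which is why the induction varies the base points. The times shift by
    \<open>s\<close> and stay below the larger sum.\<close>
  moreover have "R (averaging u ss (u s p)) (averaging v ss (v s q))"
  proof (rule Cons.IH)
    fix r assume "0 \<le> r" "r \<le> sum_list ss"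
    then have "R (u (r + s) p) (v (r + s) q)" using Cons.prems(2)[of "r + s"] s by auto
    then show "R (u r (u s p)) (v r (v s q))" by (simp add: affine_flowD[OF u] affine_flowD[OF v])
  qed (use Cons.prems in auto)
  ultimately show ?case
    by (simp add: half_step_def averaging_flow[OF u] averaging_flow[OF v] R)
qed

text \<open>A ball around \<open>q\<close> is closed under midpoints, so it contains the average as
  soon as it contains the orbit segment being averaged.\<close>

lemma averaging_dist_le:
  assumes u: "affine_flow u" and nn: "\<And>s. s \<in> set ss \<Longrightarrow> s \<ge> 0"
    and B: "\<And>s. 0 \<le> s \<Longrightarrow> s \<le> sum_list ss \<Longrightarrow> norm (u s p - q) \<le> B"
  shows "norm (averaging u ss p - q) \<le> B"
proof -
  have "(\<lambda>a b. norm (a - q) \<le> B) (averaging u ss p) (averaging u ss p)"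
  proof (rule averaging_relation[OF u u _ nn])
    fix a b c d assume "norm (a - q) \<le> B" "norm (c - q) \<le> B"
    then show "norm (midpoint a c - q) \<le> B"
      using norm_midpoint_diff_le[of a q B c q] by simp
  qed (use B in auto)
  then show ?thesis .
qed

text \<open>\<open>T\<close> commutes with the average, which is nonexpansive. Central elements are
  the main application: averaging over other flows never increases their displacements.\<close>

lemma displacement_averaging_le:
  assumes "affine_isometry T" "\<And>s q. T (u s q) = u s (T q)" "affine_flow u"
  shows "norm (T (averaging u ss q) - averaging u ss q) \<le> norm (T q - q)"
proof -
  have "T (averaging u ss q) = averaging u ss (T q)"
    by (rule averaging_commute[OF assms(1)]) (rule assms(2))
  then show ?thesis using averaging_nonexp[OF assms(3)] by simp
qed

lemma flow_displacement_add:
  assumes u: "affine_flow u"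
  shows "norm (u (s + t) p - p) \<le> norm (u s p - p) + norm (u t p - p)"
proof -
  have "norm (u (s + t) p - p) \<le> norm (u s (u t p) - u s p) + norm (u s p - p)"
    using norm_triangle_ineq[of "u s (u t p) - u s p" "u s p - p"] by (simp add: affine_flowD[OF u])
  then show ?thesis by (simp add: affine_flowD(4)[OF u])
qed

lemma flow_displacement_mult:
  assumes u: "affine_flow u"
  shows "norm (u (real n * s) p - p) \<le> real n * norm (u s p - p)"
proof (induction n)
  case 0 then show ?case by (simp add: affine_flowD[OF u])
next
  case (Suc n)
  have "real (Suc n) * s = s + real n * s" by (simp add: algebra_simps)
  then show ?case using flow_displacement_add[OF u, of s "real n * s" p] Suc by (simp add: algebra_simps)
qed

lemma flow_displacement_minus:
  assumes u: "affine_flow u"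
  shows "norm (u (- s) p - p) = norm (u s p - p)"
proof -
  have "norm (u (- s) p - p) = norm (u s (u (- s) p) - u s p)" by (simp add: affine_flowD(4)[OF u])
  then show ?thesis by (simp add: affine_flowD[OF u] norm_minus_commute)
qed

text \<open>For a uniform average over \<open>2 ^ n\<close> consecutive multiples of
  \<open>\<tau>\<close>, a shift by \<open>\<tau>\<close> only exchanges the first term for one past
  the last.\<close>

lemma geometric_averaging_telescope:
  assumes u: "affine_flow u"
  shows "u \<tau> (averaging u (map (\<lambda>i. \<tau> * 2 ^ i) [0..<n]) p) - averaging u (map (\<lambda>i. \<tau> * 2 ^ i) [0..<n]) p
     = (1 / 2 ^ n) *\<^sub>R (u (\<tau> * 2 ^ n) p - p)"
proof (induction n arbitrary: p)
  case (Suc n)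
  let ?h = "half_step u (\<tau> * 2 ^ n) p" and ?A = "averaging u (map (\<lambda>i. \<tau> * 2 ^ i) [0..<n])"
  have eq: "averaging u (map (\<lambda>i. \<tau> * 2 ^ i) [0..<Suc n]) p = ?A ?h"
    by simp
  have "u (\<tau> * 2 ^ n) (half_step u (\<tau> * 2 ^ n) p) - half_step u (\<tau> * 2 ^ n) p
      = (1/2) *\<^sub>R (u (\<tau> * 2 ^ Suc n) p - p)"
    by (simp add: half_step_def affine_flowD[OF u]) (simp add: midpoint_def algebra_simps)
  with Suc[of ?h] have "u \<tau> (?A ?h) - ?A ?h = (1 / 2 ^ n) *\<^sub>R (1/2) *\<^sub>R (u (\<tau> * 2 ^ Suc n) p - p)"
    by (simp only:)
  then show ?case unfolding eq scaleR_scaleR by (simp only: power_Suc divide_divide_eq_left times_divide_times_eq mult_1 mult.commute)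
qed simp

section \<open>Contraction in the Heisenberg group\<close>

text \<open>If averaging hardly shortens \<open>w\<close>, then \<open>Y\<close> moves
  \<open>w\<close>, and \<open>X\<close> moves the midpoint \<open>w'\<close>, by less than a
  twelfth of their norms. As \<open>w'\<close> is within \<open>1/24\<close> of \<open>w\<close>,
  relative to \<open>norm w\<close>, \<open>X\<close> moves \<open>w\<close> by at most
  \<open>1/24 + 1/12 + 1/24 = 1/6\<close>. Then \<open>Z\<close> moves \<open>w\<close> by at most
  \<open>2 * (1/12 + 1/6) = 1/2\<close>, which leaves \<open>3/2\<close> for
  \<open>w + Z w\<close>.\<close>

lemma additive_isometries_contraction:
  fixes X Y Z :: "'a::real_normed_vector \<Rightarrow> 'a"
  assumes uc: "\<And>a b::'a. norm a = norm b \<Longrightarrow> (1/12) * norm a \<le> norm (a - b) \<Longrightarrow>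
       norm (midpoint a b) \<le> (1 - \<delta>) * norm a"
    and X: "\<forall>a b. X (a + b) = X a + X b" "\<forall>v. norm (X v) = norm v"
    and Y: "\<forall>a b. Y (a + b) = Y a + Y b" "\<forall>v. norm (Y v) = norm v"
    and Z: "\<forall>a b. Z (a + b) = Z a + Z b" "\<forall>v. norm (Z v) = norm v"
    and comm: "X (Y w) = Z (Y (X w))" and \<delta>: "0 < \<delta>" "\<delta> \<le> 1"
    and large: "norm (midpoint (midpoint w (Y w)) (X (midpoint w (Y w)))) > (1 - \<delta>) * norm w"
  shows "norm (w + Z w) \<ge> (3/2) * norm w"
proof -
  define w' where "w' = midpoint w (Y w)"
  have mid: "norm (midpoint a b) \<le> norm a" if "norm a = norm b" for a b :: 'a
    using norm_midpoint_diff_le[of a 0 "norm a" b 0] that by simp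
  have l1: "norm (midpoint w' (X w')) \<le> norm w'" using mid X by metis
  have l2: "norm w' \<le> norm w" unfolding w'_def using mid Y by metis
  have yw: "norm (w - Y w) < norm w / 12"
  proof (rule ccontr)
    assume "\<not> ?thesis"
    then have "norm w' \<le> (1 - \<delta>) * norm w" unfolding w'_def using uc[of w "Y w"] Y by simp
    then show False using large l1 unfolding w'_def[symmetric] by simp
  qed
  have "norm (w' - X w') < norm w' / 12"
  proof (rule ccontr)
    assume "\<not> ?thesis"
    then have "norm (midpoint w' (X w')) \<le> (1 - \<delta>) * norm w'" using uc[of w' "X w'"] X by simp
    also have "\<dots> \<le> (1 - \<delta>) * norm w" using l2 \<delta> by (simp add: mult_left_mono)
    finally show False using large unfolding w'_def[symmetric] by simp
  qed
  then have xw': "norm (w' - X w') \<le> norm w / 12" using l2 by linarith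
  have "w - w' = (1/2) *\<^sub>R (w - Y w)"
    unfolding w'_def midpoint_def by (simp add: algebra_simps flip: scaleR_left.add)
  then have ww': "norm (w - w') \<le> norm w / 24" using yw by simp
  have Xd: "X (a - b) = X a - X b" and Yd: "Y (a - b) = Y a - Y b" and Zd: "Z (a - b) = Z a - Z b" for a b
    using additive_diff_half(1)[OF X(1)] additive_diff_half(1)[OF Y(1)] additive_diff_half(1)[OF Z(1)] by auto
  have "w - X w = (w - w') + (w' - X w') - X (w - w')" by (simp add: Xd)
  then have "norm (w - X w) \<le> norm (w - w') + norm (w' - X w') + norm (X (w - w'))"
    by (metis norm_triangle_le_diff norm_triangle_ineq add_mono order_refl)
  then have xw: "norm (w - X w) \<le> norm w / 6" using ww' xw' X by simp
  \<comment> \<open>By \<open>comm\<close>, \<open>w - Z w\<close> is the difference of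
    \<open>w - X (Y w)\<close> and \<open>Z (w - Y (X w))\<close>.\<close>
  have e: "norm (w - Z w) \<le> norm (w - X (Y w)) + norm (Z (w - Y (X w)))"
    using norm_triangle_ineq4[of "w - X (Y w)" "Z (w - Y (X w))"] by (simp add: Zd comm)
  have "w - X (Y w) = (w - X w) + X (w - Y w)" by (simp add: Xd)
  then have e1: "norm (w - X (Y w)) \<le> norm (w - X w) + norm (w - Y w)"
    using norm_triangle_ineq X(2) by metis
  have "w - Y (X w) = (w - Y w) + Y (w - X w)" by (simp add: Yd)
  then have e2: "norm (w - Y (X w)) \<le> norm (w - Y w) + norm (w - X w)"
    using norm_triangle_ineq Y(2) by metis
  have "norm (w - Z w) \<le> norm w / 2" using e e1 e2 yw xw Z(2) by simp
  moreover have "2 *\<^sub>R w = (w + Z w) + (w - Z w)" by (simp add: scaleR_2)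
  then have "2 * norm w \<le> norm (w + Z w) + norm (w - Z w)"
    by (metis norm_scaleR norm_triangle_ineq abs_numeral)
  ultimately show ?thesis by simp
qed

section \<open>Heisenberg triples of flows\<close>

locale heisenberg_flows =
  fixes x y z :: "real \<Rightarrow> 'a::real_normed_vector \<Rightarrow> 'a"
  assumes x: "affine_flow x" and y: "affine_flow y" and z: "affine_flow z"
    and zx: "z r (x s q) = x s (z r q)"
    and zy: "z r (y s q) = y s (z r q)"
    and xy: "x s (y t q) = z (s * t) (y t (x s q))"
begin

text \<open>Moving \<open>y t\<close> past \<open>x s\<close> costs the central factor
  \<open>z (s * t)\<close>, and an average over \<open>ss\<close> involves only times
  \<open>s\<close> up to \<open>sum_list ss\<close>. The bound on the error passes to midpoints,
  hence to the average.\<close>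

lemma averaging_almost_commute:
  assumes nn: "\<And>s. s \<in> set ss \<Longrightarrow> s \<ge> 0" and t: "t \<ge> 0"
    and e: "\<And>r. 0 \<le> r \<Longrightarrow> r \<le> t * sum_list ss \<Longrightarrow> norm (z r q - q) \<le> e"
  shows "norm (y t (averaging x ss q) - averaging x ss (y t q)) \<le> e"
proof (rule averaging_relation[OF x x _ nn, where R = "\<lambda>a b. norm (y t a - b) \<le> e"])
  fix a b c d assume "norm (y t a - b) \<le> e" "norm (y t c - d) \<le> e"
  then show "norm (y t (midpoint a c) - midpoint b d) \<le> e"
    by (simp add: affine_flowD(5)[OF y] norm_midpoint_diff_le)
next
  fix s assume s: "0 \<le> s" "s \<le> sum_list ss"
  have "norm (y t (x s q) - x s (y t q)) = norm (y t (x s q) - y t (x s (z (s * t) q)))"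
    by (simp add: xy zx zy)
  also have "\<dots> = norm (z (s * t) q - q)"
    by (simp add: affine_flowD(4)[OF y] affine_flowD(4)[OF x] norm_minus_commute)
  also have "\<dots> \<le> e"
    using s t by (intro e) (simp_all add: mult.commute[of s] mult_left_mono)
  finally show "norm (y t (x s q) - x s (y t q)) \<le> e" .
qed

lemma center_displacement_x:
  "norm (z r (averaging x ss q) - averaging x ss q) \<le> norm (z r q - q)"
  by (rule displacement_averaging_le[OF affine_flowD(1)[OF z] zx x])

lemma center_displacement_y:
  "norm (z r (averaging y ss q) - averaging y ss q) \<le> norm (z r q - q)"
  by (rule displacement_averaging_le[OF affine_flowD(1)[OF z] zy y])

text \<open>The half step at \<open>s\<close> can be applied first, as half steps of
  \<open>x\<close> commute; the later ones do not increase central displacements.\<close>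

lemma center_displacement_mem:
  assumes "s \<in> set ss"
  shows "norm (z r (averaging x ss q) - averaging x ss q) \<le> norm (z r (half_step x s q) - half_step x s q)"
  using assms
proof (induction ss)
  case (Cons s' ss)
  show ?case
  proof (cases "s = s'")
    case True
    have "averaging x (s' # ss) q = averaging x ss (half_step x s q)"
      using averaging_half_step_commute[OF x _ x, of s ss q] True
      by (simp add: affine_flowD[OF x] add.commute)
    then show ?thesis using center_displacement_x by metis
  next
    case False
    then show ?thesis
      using Cons center_displacement_x[of r "[s']" "averaging x ss q"] by auto
  qed
qed simp

lemma displacement_diff:
  "norm (z r p - p) \<le> norm (z r q - q) + 2 * norm (p - q)"
proof -
  have "z r p - p = (z r p - z r q) + (z r q - q) + (q - p)" by simp
  then have "norm (z r p - p) \<le> norm (z r p - z r q) + norm (z r q - q) + norm (q - p)"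
    by (metis norm_triangle_ineq norm_triangle_le add_mono order_refl)
  then show ?thesis by (simp add: affine_flowD(4)[OF z] norm_minus_commute)
qed

end

text \<open>A single \<open>\<delta>\<close> works for all Heisenberg triples and all scales. In the
  second alternative the displacement has not shrunk, but it grows by the factor \<open>3/2\<close>
  when the central parameter is doubled; this cannot go on for long where displacements are
  bounded.\<close>

lemma heisenberg_contraction:
  assumes "uniformly_convex TYPE('a::real_normed_vector)"
  obtains \<delta> where "0 < \<delta>" "\<delta> \<le> 1 / 9"
    "\<And>x y z s t. \<And>q::'a. heisenberg_flows x y z \<Longrightarrow>
      norm (z (s * t) (half_step x s (half_step y t q)) - half_step x s (half_step y t q))
        \<le> (1 - \<delta>) * norm (z (s * t) q - q) \<or>
      norm (z (s * t) q - q) \<le> (2/3) * norm (z (2 * (s * t)) q - q)"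
proof -
  obtain \<delta>0 where \<delta>0: "\<delta>0 > 0" "\<And>a b::'a. norm a = norm b \<Longrightarrow> (1/12) * norm a \<le> norm (a - b) \<Longrightarrow>
       norm (midpoint a b) \<le> (1 - \<delta>0) * norm a"
    using uniformly_convex_scaled[OF assms, of "1/12"] by auto
  \<comment> \<open>The cap \<open>1/9\<close> gives \<open>8/9 \<le> 1 - \<delta>\<close>, where
    \<open>8/9 = (2/3) * (4/3)\<close> is the weighted gain of the second alternative in
    \<open>band_displacement_le\<close>.\<close>
  define \<delta> where "\<delta> = min \<delta>0 (1/9)"
  have uc: "norm (midpoint a b) \<le> (1 - \<delta>) * norm a"
    if "norm a = norm b" "(1/12) * norm a \<le> norm (a - b)" for a b :: 'a
    using \<delta>0(2)[OF that] mult_right_mono[of "1 - \<delta>0" "1 - \<delta>" "norm a"] by (simp add: \<delta>_def)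
  have \<delta>: "0 < \<delta>" "\<delta> \<le> 1" "\<delta> \<le> 1/9" using \<delta>0(1) by (auto simp: \<delta>_def)
  show thesis
  proof (rule that[OF \<delta>(1,3)])
    fix x y z :: "real \<Rightarrow> 'a \<Rightarrow> 'a" and s t q
    assume "heisenberg_flows x y z"
    then interpret heisenberg_flows x y z .
    obtain X where X: "\<forall>a b. X (a + b) = X a + X b" "\<forall>v. norm (X v) = norm v" "\<And>p q. x s p - x s q = X (p - q)"
      using affine_flowD(1)[OF x, of s] unfolding affine_isometry_def by blast
    obtain Y where Y: "\<forall>a b. Y (a + b) = Y a + Y b" "\<forall>v. norm (Y v) = norm v" "\<And>p q. y t p - y t q = Y (p - q)"
      using affine_flowD(1)[OF y, of t] unfolding affine_isometry_def by blast
    obtain Z where Z: "\<forall>a b. Z (a + b) = Z a + Z b" "\<forall>v. norm (Z v) = norm v"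
      "\<And>p q. z (s * t) p - z (s * t) q = Z (p - q)"
      using affine_flowD(1)[OF z, of "s * t"] unfolding affine_isometry_def by blast
    define w where "w = z (s * t) q - q"
    have xw: "z (s * t) (half_step x s p) - half_step x s p
      = midpoint (z (s * t) p - p) (X (z (s * t) p - p))" for p
      by (simp add: half_step_def affine_flowD(5)[OF z] X(3)[symmetric] zx)
        (simp add: midpoint_def algebra_simps)
    have yw: "z (s * t) (half_step y t q) - half_step y t q = midpoint w (Y w)"
      by (simp add: w_def half_step_def affine_flowD(5)[OF z] Y(3)[symmetric] zy)
        (simp add: midpoint_def algebra_simps)
    have Zw: "w + Z w = z (2 * (s * t)) q - q"
      by (simp add: w_def Z(3)[symmetric] affine_flowD(3)[OF z])
    have "X (Y w) = x s (y t (z (s * t) q)) - x s (y t q)"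
      by (simp add: w_def X(3) Y(3))
    also have "\<dots> = Z (Y (X w))" by (simp add: w_def X(3) Y(3) Z(3) xy)
    finally have comm: "X (Y w) = Z (Y (X w))" .
    show "norm (z (s * t) (half_step x s (half_step y t q)) - half_step x s (half_step y t q))
        \<le> (1 - \<delta>) * norm (z (s * t) q - q) \<or>
      norm (z (s * t) q - q) \<le> (2/3) * norm (z (2 * (s * t)) q - q)"
      using additive_isometries_contraction[OF uc X(1,2) Y(1,2) Z(1,2) comm \<delta>(1,2)]
      unfolding xw yw Zw unfolding w_def[symmetric] by force
  qed
qed

text \<open>The scales of \<open>x\<close> come in \<open>n\<close> blocks of \<open>G\<close> consecutive dyadic scales, separated by gaps of the
  same size; the \<open>i\<close>-th block is paired with the \<open>i\<close>-th scale of \<open>y\<close>.\<close>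
primrec x_scales :: "real \<Rightarrow> nat \<Rightarrow> nat \<Rightarrow> real list" where
  "x_scales a G 0 = []"
| "x_scales a G (Suc n) = map (\<lambda>j. a * 4 ^ (G * n) * 2 ^ j) [0..<G] @ x_scales a G n"

text \<open>The scales shrink as the blocks of \<open>x_scales\<close> grow, so that every block,
  multiplied by its partner, yields the same central parameters \<open>a * t * 2 ^ j\<close> with
  \<open>j < G\<close>.\<close>

primrec y_scales :: "real \<Rightarrow> nat \<Rightarrow> nat \<Rightarrow> real list" where
  "y_scales t G 0 = []"
| "y_scales t G (Suc n) = (t / 4 ^ (G * n)) # y_scales t G n"

lemma sum_list_geometric: "sum_list (map (\<lambda>j. b * 2 ^ j) [0..<n]) = b * (2 ^ n - 1)" for b :: real
  by (induction n) (auto simp: algebra_simps)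

lemma x_scales_pos: "a > 0 \<Longrightarrow> s \<in> set (x_scales a G n) \<Longrightarrow> s > 0"
  by (induction n) auto

text \<open>Because of the gaps, the first \<open>n\<close> blocks together are smaller by
  \<open>2 ^ G\<close> than the first scale of the next block. This keeps the cost of sorting
  small.\<close>

lemma sum_list_x_scales:
  assumes "a > 0" "G > 0"
  shows "sum_list (x_scales a G n) \<le> a * 4 ^ (G * n) / 2 ^ G"
proof (induction n)
  case (Suc n)
  have p: "(4::real) ^ (G * n) * 4 ^ G = 4 ^ (G * Suc n)" by (simp add: power_add)
  have g: "(4::real) ^ G = 2 ^ G * 2 ^ G" by (simp flip: power_mult_distrib)
  have "sum_list (x_scales a G (Suc n)) \<le> a * 4 ^ (G * n) * (2 ^ G - 1) + a * 4 ^ (G * n) / 2 ^ G"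
    using Suc sum_list_geometric[of "a * 4 ^ (G * n)" G] by simp
  also have "\<dots> \<le> a * 4 ^ (G * n) * (2 ^ G - 1) + a * 4 ^ (G * n)"
    using assms by (simp add: divide_le_eq)
  also have "\<dots> = a * 4 ^ (G * Suc n) / 2 ^ G"
    unfolding p[symmetric] by (simp add: g right_diff_distrib)
  finally show ?case .
qed (use assms in simp)

context heisenberg_flows
begin

text \<open>One pair of factors contracts the displacement by a single central element. A pair consisting
  of a block of \<open>G\<close> consecutive dyadic scales of \<open>x\<close> and one scale of \<open>y\<close> contracts the weighted
  supremum of the displacements by \<open>z (c * 2 ^ j)\<close>, \<open>j \<le> G\<close>. The scales are sparse enough for the
  factors to be sorted at small cost.\<close>
lemma band_displacement_le:
  assumes contr: "\<And>s t q. norm (z (s * t) (half_step x s (half_step y t q)) - half_step x s (half_step y t q))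
        \<le> (1 - \<delta>) * norm (z (s * t) q - q) \<or>
      norm (z (s * t) q - q) \<le> (2/3) * norm (z (2 * (s * t)) q - q)"
    and \<delta>: "0 < \<delta>" "\<delta> \<le> 1 / 9" and c: "c > 0" and t: "t > 0" and G: "G > 0"
    and \<Lambda>: "\<And>j. j \<le> G \<Longrightarrow> norm (z (c * 2 ^ j) q - q) \<le> \<Lambda>"
    and e: "\<And>r. 0 \<le> r \<Longrightarrow> r \<le> c / 2 ^ G \<Longrightarrow> norm (z r q - q) \<le> e"
    and j: "j \<le> G"
  shows "norm (z (c * 2 ^ j) (averaging x (x_scales (c / t) G n) (averaging y (y_scales t G n) q))
      - averaging x (x_scales (c / t) G n) (averaging y (y_scales t G n) q))
    \<le> (((1 - \<delta>) ^ n + (3 / 4) ^ G) * \<Lambda> + n * e) * (4 / 3) ^ j"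
  using j
proof (induction n arbitrary: j)
  have L0: "\<Lambda> \<ge> 0" using \<Lambda>[of 0] norm_ge_zero order_trans by blast
  have e0: "e \<ge> 0" using order_trans[OF norm_ge_zero e[of 0]] c by simp
  have f1: "(1::real) \<le> (4/3) ^ j" for j :: nat by simp
  {
    case 0
    have "1 * 1 \<le> (1 + (3/4) ^ G) * (4/3::real) ^ j" by (intro mult_mono) auto
    from mult_right_mono[OF this L0] have "\<Lambda> \<le> (1 + (3/4) ^ G) * (4/3) ^ j * \<Lambda>" by simp
    also have "\<dots> = (1 + (3/4) ^ G) * \<Lambda> * (4/3) ^ j" by simp
    finally show ?case using \<Lambda>[OF 0] by simp
  next
    case (Suc n)
    define xs where "xs = x_scales (c / t) G n"
    define v where "v = averaging y (y_scales t G n) q"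
    define t' where "t' = t / 4 ^ (G * n)"
    define B where "B m = ((1 - \<delta>) ^ m + (3 / 4) ^ G) * \<Lambda> + real m * e" for m
    define bl where "bl = map (\<lambda>j. c / t * 4 ^ (G * n) * 2 ^ j) [0..<G]"
    define p where "p = averaging x xs v"
    \<comment> \<open>\<open>p1\<close> applies the new pair to the point \<open>p\<close> of the
      induction hypothesis, so it contracts. In the sorted product \<open>p2\<close> the new half
      step of \<open>y\<close> precedes the old ones of \<open>x\<close>. They differ by one
      commutation error, at most \<open>e / 2\<close>.\<close>
    define p1 where "p1 = averaging x bl (half_step y t' p)"
    define p2 where "p2 = averaging x (x_scales (c / t) G (Suc n)) (averaging y (y_scales t G (Suc n)) q)"
    have t': "t' > 0" using t by (simp add: t'_def)
    have ct: "c / t > 0" using c t by simp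
    have p2: "p2 = averaging x bl (averaging x xs (half_step y t' v))"
      by (simp add: p2_def bl_def xs_def v_def t'_def)
    have IH: "norm (z (c * 2 ^ i) p - p) \<le> B n * (4/3) ^ i" if "i \<le> G" for i
      using Suc.IH[OF that] by (simp add: p_def xs_def v_def B_def)
    have "norm (p2 - p1) \<le> norm (averaging x xs (half_step y t' v) - half_step y t' p)"
      unfolding p1_def p2 by (rule averaging_nonexp[OF x])
    also have "\<dots> = norm (averaging x xs (y t' v) - y t' p) / 2"
    proof -
      have "averaging x xs (half_step y t' v) - half_step y t' p
          = (1/2) *\<^sub>R (averaging x xs (y t' v) - y t' p)"
        unfolding half_step_def averaging_midpoint[OF x] p_def[symmetric]
        by (simp add: midpoint_def algebra_simps)
      then show ?thesis by simp
    qed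
    also have "norm (averaging x xs (y t' v) - y t' p) \<le> e"
      unfolding p_def norm_minus_commute[of "averaging x xs (y t' v)"]
    proof (rule averaging_almost_commute)
      show "s \<ge> 0" if "s \<in> set xs" for s
        using x_scales_pos[OF ct] that unfolding xs_def by fastforce
      fix r assume r: "0 \<le> r" "r \<le> t' * sum_list xs"
      have "t' * sum_list xs \<le> t' * (c / t * 4 ^ (G * n) / 2 ^ G)"
        unfolding xs_def using sum_list_x_scales[OF ct G] t' by (intro mult_left_mono) auto
      also have "\<dots> = c / 2 ^ G" using t by (simp add: t'_def)
      finally have "r \<le> c / 2 ^ G" using r by simp
      from e[OF r(1) this] show "norm (z r v - v) \<le> e"
        unfolding v_def using center_displacement_y order_trans by blast
    qed (use t' in simp)
    finally have d12: "norm (p2 - p1) \<le> e / 2" by simp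
    have B0: "B m \<ge> 0" for m using L0 e0 \<delta> by (simp add: B_def)
    have BS: "(1 - \<delta>) * B n + e \<le> B (Suc n)"
    proof -
      have "(1 - \<delta>) * ((3 / 4) ^ G * \<Lambda> + n * e) \<le> 1 * ((3 / 4) ^ G * \<Lambda> + n * e)"
        using \<delta> L0 e0 by (intro mult_right_mono) auto
      then show ?thesis by (simp add: B_def algebra_simps)
    qed
    have "norm (z (c * 2 ^ j) p2 - p2) \<le> B (Suc n) * (4/3) ^ j"
    proof (cases "j = G")
      \<comment> \<open>At the top of the range no larger central parameter is available for
        comparison. The trivial bound \<open>\<Lambda>\<close> suffices there, because the term
        \<open>(3 / 4) ^ G\<close> of \<open>B\<close> cancels the weight
        \<open>(4 / 3) ^ G\<close>.\<close>
      case True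
      have "norm (z (c * 2 ^ j) p2 - p2) \<le> norm (z (c * 2 ^ j) q - q)"
        unfolding p2_def using center_displacement_x center_displacement_y order_trans by blast
      also have "\<dots> \<le> \<Lambda>" using \<Lambda> Suc.prems by simp
      also have "\<Lambda> = (3/4) ^ G * \<Lambda> * (4/3) ^ j"
      proof -
        have "(3/4::real) ^ G * (4/3) ^ j = 1" unfolding True by (simp flip: power_mult_distrib)
        then show ?thesis by (metis mult.assoc mult.commute mult_1)
      qed
      also have "\<dots> \<le> B (Suc n) * (4/3) ^ j"
        using L0 e0 \<delta> by (intro mult_right_mono) (auto simp: B_def distrib_right)
      finally show ?thesis .
    next
      case False
      then have jG: "j < G" using Suc.prems by simp
      define s where "s = c / t * 4 ^ (G * n) * 2 ^ j"
      have st: "s * t' = c * 2 ^ j" using t by (simp add: s_def t'_def)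
      have "s \<in> set bl" using jG by (auto simp: bl_def s_def)
      then have le: "norm (z (c * 2 ^ j) p1 - p1)
          \<le> norm (z (c * 2 ^ j) (half_step x s (half_step y t' p)) - half_step x s (half_step y t' p))"
        unfolding p1_def by (rule center_displacement_mem)
      have le2: "norm (z (c * 2 ^ j) p1 - p1) \<le> norm (z (c * 2 ^ j) p - p)"
        unfolding p1_def using center_displacement_x center_displacement_y[of _ "[t']" p, simplified]
        by (meson order_trans)
      from contr[of s t' p, unfolded st]
      have "norm (z (c * 2 ^ j) p1 - p1) \<le> (1 - \<delta>) * B n * (4/3) ^ j"
      proof
        assume "norm (z (c * 2 ^ j) (half_step x s (half_step y t' p)) - half_step x s (half_step y t' p))
          \<le> (1 - \<delta>) * norm (z (c * 2 ^ j) p - p)"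
        also have "\<dots> \<le> (1 - \<delta>) * (B n * (4/3) ^ j)"
          using IH[of j] jG \<delta> by (intro mult_left_mono) auto
        finally show ?thesis using le by simp
      next
        assume "norm (z (c * 2 ^ j) p - p) \<le> (2/3) * norm (z (2 * (c * 2 ^ j)) p - p)"
        also have "2 * (c * 2 ^ j) = c * 2 ^ Suc j" by simp
        also have "(2/3) * norm (z (c * 2 ^ Suc j) p - p) \<le> (2/3) * (B n * (4/3) ^ Suc j)"
          using IH[of "Suc j"] jG by simp
        \<comment> \<open>Passing to \<open>Suc j\<close> costs the weight \<open>4/3\<close> but
          gains \<open>2/3\<close>.\<close>
        also have "\<dots> = (8/9) * (B n * (4/3) ^ j)" by simp
        also have "\<dots> \<le> (1 - \<delta>) * (B n * (4/3) ^ j)"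
          using \<delta> B0 by (intro mult_right_mono) auto
        finally show ?thesis using le2 by simp
      qed
      moreover have "e * 1 \<le> e * (4/3) ^ j" using e0 f1 by (rule mult_left_mono[rotated])
      ultimately have "norm (z (c * 2 ^ j) p2 - p2) \<le> ((1 - \<delta>) * B n + e) * (4/3) ^ j"
        using displacement_diff[of "c * 2 ^ j" p2 p1] d12 by (simp add: distrib_right)
      also have "\<dots> \<le> B (Suc n) * (4/3) ^ j" using BS by (intro mult_right_mono) auto
      finally show ?thesis .
    qed
    then show ?case by (simp only: p2_def B_def)
  }
qed

end

section \<open>Frequency bands\<close>

text \<open>The resolution is \<open>1 / 2 ^ m\<close>, and averaging over
  \<open>dyadic m (m + n)\<close> covers times from \<open>0\<close> to just below
  \<open>2 ^ n\<close>. Later \<open>m\<close> tends to infinity with the range fixed.\<close>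

definition dyadic :: "nat \<Rightarrow> nat \<Rightarrow> real list" where
  "dyadic m n = map (\<lambda>i. 1 / 2 ^ m * 2 ^ i) [0..<n]"

lemma dyadic_pos: "s \<in> set (dyadic m n) \<Longrightarrow> s > 0"
  by (auto simp: dyadic_def)

lemma dyadic_nonneg: "s \<in> set (dyadic m n) \<Longrightarrow> s \<ge> 0"
  using dyadic_pos less_imp_le by blast

lemma sum_list_dyadic: "sum_list (dyadic m n) \<le> 2 ^ n / 2 ^ m"
  unfolding dyadic_def sum_list_geometric by (simp add: field_simps)

text \<open>A shift by a multiple of the resolution is controlled by the telescoping identity; the
  remainder, shorter than \<open>1 / 2 ^ m\<close>, is left to continuity through
  \<open>\<omega>\<close>.\<close>

lemma smoothing:
  assumes u: "affine_flow u" and r: "0 \<le> r"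
    and \<omega>: "\<And>r. 0 \<le> r \<Longrightarrow> r \<le> 1 / 2 ^ m \<Longrightarrow> norm (u r p - p) \<le> \<omega>"
  shows "norm (u r (averaging u (dyadic m k) p) - averaging u (dyadic m k) p)
    \<le> r / (2 ^ k / 2 ^ m) * norm (u (2 ^ k / 2 ^ m) p - p) + \<omega>"
proof -
  define \<tau> :: real where "\<tau> = 1 / 2 ^ m"
  have \<tau>: "\<tau> > 0" by (simp add: \<tau>_def)
  define A where "A = averaging u (dyadic m k) p"
  define n where "n = nat \<lfloor>r / \<tau>\<rfloor>"
  have n: "real n \<le> r / \<tau>" "r / \<tau> < real n + 1" using r \<tau> by (auto simp: n_def)
  define r' where "r' = r - real n * \<tau>"
  have r': "0 \<le> r'" "r' \<le> 1 / 2 ^ m" using n \<tau> by (auto simp: r'_def field_simps simp flip: \<tau>_def)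
  have "norm (u r A - A) = norm (u (real n * \<tau> + r') A - A)" by (simp add: r'_def)
  also have "\<dots> \<le> norm (u (real n * \<tau>) A - A) + norm (u r' A - A)" by (rule flow_displacement_add[OF u])
  also have "norm (u (real n * \<tau>) A - A) \<le> real n * norm (u \<tau> A - A)" by (rule flow_displacement_mult[OF u])
  also have "norm (u \<tau> A - A) = norm (u (\<tau> * 2 ^ k) p - p) / 2 ^ k"
    unfolding A_def dyadic_def \<tau>_def[symmetric] geometric_averaging_telescope[OF u] by simp
  also have "norm (u r' A - A) \<le> norm (u r' p - p)"
    unfolding A_def by (rule displacement_averaging_le[OF affine_flowD(1)[OF u] _ u])
      (simp add: affine_flowD[OF u] add.commute)
  also have "\<dots> \<le> \<omega>" by (rule \<omega>[OF r'])
  also have "real n * (norm (u (\<tau> * 2 ^ k) p - p) / 2 ^ k) \<le> r / \<tau> * (norm (u (\<tau> * 2 ^ k) p - p) / 2 ^ k)"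
    using n by (intro mult_right_mono) auto
  finally show ?thesis by (simp add: A_def \<tau>_def)
qed

section \<open>Finding the paired scales among the dyadic ones\<close>

lemma x_scales_less:
  assumes "a > 0" "s \<in> set (x_scales a G n)" shows "s < a * 4 ^ (G * n)"
  using assms(2)
proof (induction n)
  case (Suc n)
  have p: "(4::real) ^ (G * n) * 4 ^ G = 4 ^ (G * Suc n)" by (simp add: power_add)
  have g: "(4::real) ^ G = 2 ^ G * 2 ^ G" by (simp flip: power_mult_distrib)
  have le: "(1::real) \<le> 2 ^ G" by simp
  from Suc.prems consider j where "j < G" "s = a * 4 ^ (G * n) * 2 ^ j" | "s < a * 4 ^ (G * n)"
    using Suc.IH by auto
  then show ?case
  proof cases
    case 1
    have "(2::real) ^ j < 2 ^ G" using 1 by simp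
    also have "\<dots> \<le> 4 ^ G" unfolding g using le by (simp add: mult_le_cancel_left1)
    finally show ?thesis unfolding p[symmetric] 1 using assms(1) by simp
  next
    case 2
    also have "a * 4 ^ (G * n) * 1 \<le> a * 4 ^ (G * n) * 4 ^ G"
      using assms(1) by (intro mult_left_mono) auto
    finally show ?thesis unfolding p[symmetric] by (simp add: mult.assoc)
  qed
qed simp

lemma distinct_x_scales: "a > 0 \<Longrightarrow> distinct (x_scales a G n)"
proof (induction n)
  case (Suc n)
  have "s \<notin> set (x_scales a G n)" if "s = a * 4 ^ (G * n) * 2 ^ j" for s j
  proof
    assume "s \<in> set (x_scales a G n)"
    from x_scales_less[OF Suc.prems this] have "a * 4 ^ (G * n) * 2 ^ j < a * 4 ^ (G * n) * 1"
      using that by simp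
    then have "2 ^ j < (1::real)" using Suc.prems by (simp only: mult_less_cancel_left_pos zero_less_mult_iff zero_less_power zero_less_numeral simp_thms)
    then show False using one_le_power[of "2::real" j] by linarith
  qed
  moreover have "inj_on (\<lambda>j. a * 4 ^ (G * n) * 2 ^ j) {0..<G}"
    using Suc.prems by (auto simp: inj_on_def)
  ultimately show ?case using Suc by (auto simp: distinct_map)
qed simp

lemma y_scales_greater:
  assumes "t > 0" "G > 0" "s \<in> set (y_scales t G n)" shows "s > t / 4 ^ (G * n)"
  using assms(3)
proof (induction n)
  case (Suc n)
  have l: "t / 4 ^ (G * Suc n) < t / 4 ^ (G * n)"
    using assms by (intro divide_strict_left_mono power_strict_increasing) auto
  show ?case using Suc l by auto
qed simp

lemma distinct_y_scales: "t > 0 \<Longrightarrow> G > 0 \<Longrightarrow> distinct (y_scales t G n)"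
proof (induction n)
  case (Suc n)
  then show ?case using y_scales_greater[of t G "t / 4 ^ (G * n)" n] by auto
qed simp

lemma four_power: "(4::real) ^ i = 2 ^ (2 * i)"
  by (simp add: power_mult)

lemma x_scales_dyadic:
  assumes "\<alpha> + 2 * G * n \<le> N"
  shows "set (x_scales (1 / 2 ^ m * 2 ^ \<alpha>) G n) \<subseteq> set (dyadic m N)"
  using assms
proof (induction n)
  case (Suc n)
  have "1 / 2 ^ m * 2 ^ \<alpha> * 4 ^ (G * n) * 2 ^ j \<in> set (dyadic m N)" if "j < G" for j
  proof -
    have "1 / 2 ^ m * 2 ^ \<alpha> * 4 ^ (G * n) * 2 ^ j = (1 / 2 ^ m * 2 ^ (\<alpha> + 2 * G * n + j) :: real)"
      by (simp add: power_add four_power mult.assoc)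
    moreover have "\<alpha> + 2 * G * n + j < N" using that Suc.prems by (simp add: algebra_simps)
    ultimately show ?thesis by (simp add: dyadic_def)
  qed
  then show ?case using Suc by (auto simp: algebra_simps)
qed simp

lemma y_scales_dyadic:
  assumes "2 * G * n \<le> N"
  shows "set (y_scales (1 / 2 ^ m * 2 ^ N) G n) \<subseteq> set (dyadic m (Suc N))"
  using assms
proof (induction n)
  case (Suc n)
  have le: "2 * G * n \<le> N" using Suc.prems by (simp add: algebra_simps)
  have "1 / 2 ^ m * 2 ^ N / 4 ^ (G * n) = (1 / 2 ^ m * 2 ^ (N - 2 * G * n) :: real)"
    using le by (simp add: four_power power_diff mult.assoc)
  moreover have "N - 2 * G * n < Suc N" by simp
  ultimately have "1 / 2 ^ m * 2 ^ N / 4 ^ (G * n) \<in> set (dyadic m (Suc N))"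
    unfolding dyadic_def set_map by (intro image_eqI[where x = "N - 2 * G * n"]) auto
  then show ?case using Suc le by auto
qed simp

context heisenberg_flows
begin

text \<open>Exchanging \<open>x\<close> and \<open>y\<close> inverts their commutator, so the center
  has to run backwards.\<close>

lemma flipped: "heisenberg_flows y x (\<lambda>r. z (- r))"
proof
  have "isCont (\<lambda>s. z (- s) p) 0" for p
    using isCont_o2[of 0 uminus "\<lambda>s. z s p"] z by (auto simp: affine_flow_def)
  moreover have "z (- (s + t)) p = z (- s) (z (- t) p)" for s t p
    by (simp add: affine_flowD[OF z])
  ultimately show "affine_flow (\<lambda>r. z (- r))"
    using z unfolding affine_flow_def by simp
  show "y s (x t q) = z (- (s * t)) (x t (y s q))" for s t q
    by (simp add: xy affine_flowD[OF z] mult.commute)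
qed (auto simp: x y zx zy)

text \<open>From the dyadic scales, \<open>G\<close> blocks of \<open>x\<close> and \<open>G\<close>
  scales of \<open>y\<close> with products \<open>c * 2 ^ j\<close> are extracted. The hypotheses on
  \<open>k\<close> and \<open>M\<close> say that the exponents of these scales lie within the dyadic
  range.\<close>

lemma dyadic_band_displacement_le:
  assumes contr: "\<And>s t q. norm (z (s * t) (half_step x s (half_step y t q)) - half_step x s (half_step y t q))
        \<le> (1 - \<delta>) * norm (z (s * t) q - q) \<or>
      norm (z (s * t) q - q) \<le> (2/3) * norm (z (2 * (s * t)) q - q)"
    and \<delta>: "0 < \<delta>" "\<delta> \<le> 1 / 9" and G: "G > 0"
    and k: "M \<le> Suc k" "M > 0" "2 * G * G + k + 1 \<le> m + 2 * M" "2 * G * G + 1 \<le> m + M"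
    and \<Lambda>: "\<And>j. j \<le> G \<Longrightarrow> norm (z (2 ^ k / 2 ^ m * 2 ^ j) q - q) \<le> \<Lambda>"
    and e: "\<And>r. 0 \<le> r \<Longrightarrow> r \<le> 2 ^ k / 2 ^ m / 2 ^ G \<Longrightarrow> norm (z r q - q) \<le> e"
  defines "q' \<equiv> averaging x (dyadic m (m + M)) (averaging y (dyadic m (m + M)) q)"
  shows "norm (z (2 ^ k / 2 ^ m) q' - q') \<le> ((1 - \<delta>) ^ G + (3 / 4) ^ G) * \<Lambda> + G * e"
proof -
  define N where "N = m + M - 1"
  have N: "m + M = Suc N" using k by (simp add: N_def)
  \<comment> \<open>The largest available scale of \<open>y\<close>; its partner
    \<open>c / t\<close> is therefore the smallest scale of \<open>x\<close> in use.\<close>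
  define t :: real where "t = 1 / 2 ^ m * 2 ^ N"
  define c :: real where "c = 2 ^ k / 2 ^ m"
  have ct0: "t > 0" "c > 0" by (auto simp: t_def c_def)
  have ct: "c / t = 1 / 2 ^ m * 2 ^ (Suc k - M)"
  proof -
    have "(2::real) ^ m * 2 ^ k = 2 ^ (Suc k - M) * 2 ^ N"
      using k by (simp add: N_def flip: power_add)
    then show ?thesis by (simp add: c_def t_def field_simps)
  qed
  have "set (x_scales (c / t) G G) \<subseteq> set (dyadic m (m + M))"
    unfolding ct by (rule x_scales_dyadic) (use k in linarith)
  \<comment> \<open>The surplus scales of \<open>x\<close> are made to act last and those of
    \<open>y\<close> first, so the selected pairs stay adjacent; neither surplus increases central
    displacements.\<close>
  from averaging_sublist[OF x distinct_x_scales this] ct0 obtain rx where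
    rx: "averaging x (dyadic m (m + M)) = averaging x (rx @ x_scales (c / t) G G)" by auto
  have "set (y_scales t G G) \<subseteq> set (dyadic m (m + M))"
    unfolding t_def N by (rule y_scales_dyadic) (use k in \<open>simp add: N_def\<close>)
  from averaging_sublist[OF y distinct_y_scales[OF ct0(1) G] this] obtain ry where
    ry: "averaging y (dyadic m (m + M)) = averaging y (y_scales t G G @ ry)" by metis
  define q1 where "q1 = averaging y ry q"
  have q1: "norm (z r q1 - q1) \<le> norm (z r q - q)" for r
    unfolding q1_def by (rule center_displacement_y)
  have "norm (z c q' - q') \<le> norm (z (c * 2 ^ 0) (averaging x (x_scales (c / t) G G) (averaging y (y_scales t G G) q1))
      - averaging x (x_scales (c / t) G G) (averaging y (y_scales t G G) q1))"
    unfolding q'_def rx ry q1_def using center_displacement_x by simp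
  also have "\<dots> \<le> (((1 - \<delta>) ^ G + (3 / 4) ^ G) * \<Lambda> + G * e) * (4 / 3) ^ 0"
    by (rule band_displacement_le[OF contr \<delta> ct0(2,1) G order_trans[OF q1 \<Lambda>[folded c_def]]
        order_trans[OF q1 e[folded c_def]]]) simp_all
  finally show ?thesis by (simp add: c_def)
qed

text \<open>Adding the scale \<open>2 ^ k / 2 ^ m\<close> to the central average applies one more
  half step of \<open>z\<close>. It commutes with all other factors, so it moves \<open>A k\<close>
  by half of its displacement.\<close>

lemma averaging_center_telescope:
  fixes p :: 'a and m :: nat and xs ys :: "real list"
  assumes "k0 \<le> K"
  defines "A \<equiv> \<lambda>k. averaging x xs (averaging y ys (averaging z (dyadic m k) p))"
  shows "norm (A K - A k0) \<le> (\<Sum>k=k0..<K. norm (z (2 ^ k / 2 ^ m) (A k) - A k) / 2)"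
  using assms(1)
proof (induction K rule: dec_induct)
  case (step k)
  have "A (Suc k) = averaging x xs (averaging y ys (half_step z (2 ^ k / 2 ^ m) (averaging z (dyadic m k) p)))"
    unfolding A_def dyadic_def
    using averaging_half_step_commute[OF z _ z, of "2 ^ k / 2 ^ m" "dyadic m k" p]
    by (simp add: affine_flowD[OF z] add.commute dyadic_def)
  also have "\<dots> = half_step z (2 ^ k / 2 ^ m) (A k)"
    unfolding A_def by (simp add: averaging_half_step_commute[OF x zx z] averaging_half_step_commute[OF y zy z])
  finally have "A (Suc k) - A k = (1/2) *\<^sub>R (z (2 ^ k / 2 ^ m) (A k) - A k)"
    by (simp add: half_step_def midpoint_def algebra_simps flip: scaleR_left.add)
  then have "norm (A (Suc k) - A k) = norm (z (2 ^ k / 2 ^ m) (A k) - A k) / 2" by simp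
  moreover have "norm (A (Suc k) - A k0) \<le> norm (A (Suc k) - A k) + norm (A k - A k0)"
    using norm_triangle_ineq[of "A (Suc k) - A k" "A k - A k0"] by simp
  ultimately show ?case using step by simp
qed simp

end

section \<open>Summability of the damping rates of the bands\<close>

definition block_length :: "nat \<Rightarrow> nat" where
  "block_length D = nat \<lfloor>sqrt (real D) / 2\<rfloor>"

definition band_decay :: "real \<Rightarrow> nat \<Rightarrow> real" where
  "band_decay \<delta> G = (1 - \<delta>) ^ G + (3 / 4) ^ G + real G / 2 ^ G"

text \<open>\<open>block_length D\<close> is the largest \<open>G\<close> with
  \<open>4 * G * G \<le> D\<close>. With gaps, \<open>G\<close> blocks of length \<open>G\<close>
  occupy \<open>2 * G * G\<close> consecutive exponents, so \<open>D\<close> leaves ample room for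
  them.\<close>

lemma block_length_le: "4 * block_length D * block_length D \<le> D"
proof -
  have "real (block_length D) \<le> sqrt (real D) / 2"
    unfolding block_length_def by (rule of_nat_floor) simp
  then have "(2 * real (block_length D))\<^sup>2 \<le> (sqrt (real D))\<^sup>2"
    by (intro power_mono) auto
  then have "real (4 * block_length D * block_length D) \<le> real D" by (simp add: power2_eq_square)
  then show ?thesis by (simp only: of_nat_le_iff)
qed

lemma block_length_greater: "real D \<le> 4 * (real (block_length D) + 1) ^ 2"
proof -
  have "sqrt (real D) / 2 \<le> real (block_length D) + 1"
    unfolding block_length_def by linarith
  then have "(sqrt (real D))\<^sup>2 \<le> (2 * (real (block_length D) + 1))\<^sup>2"
    by (intro power_mono) auto
  then have "real D \<le> (2 * (real (block_length D) + 1))\<^sup>2" by simp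
  then show ?thesis unfolding power_mult_distrib by simp
qed

lemma block_length_pos: "D \<ge> 4 \<Longrightarrow> block_length D > 0"
proof -
  assume "D \<ge> 4"
  then have "2 \<le> sqrt (real D)" by (intro real_le_rsqrt) simp
  then have "1 \<le> sqrt (real D) / 2" by simp
  then show ?thesis unfolding block_length_def by linarith
qed

text \<open>Exponential decay beats any power. The tenth is chosen because \<open>D\<close> is at
  most \<open>4 * (G + 1) ^ 2\<close> for \<open>G = block_length D\<close>: this yields decay like
  \<open>D ^ -5\<close>, three powers for the factor \<open>a ^ -3\<close> and two for
  summability.\<close>

lemma band_decay_bound:
  assumes "0 < \<delta>" "\<delta> < 1"
  obtains C where "\<And>G. band_decay \<delta> G * (real G + 1) ^ 10 \<le> C"
proof -
  have 1: "(\<lambda>n::nat. r ^ n * (real n + 1) ^ 10) \<longlonglongrightarrow> 0" if "0 < r" "r < 1" for r :: real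
    using that by real_asymp
  have 2: "(\<lambda>n::nat. real n / 2 ^ n * (real n + 1) ^ 10) \<longlonglongrightarrow> 0"
    by real_asymp
  have "(\<lambda>n. (1 - \<delta>) ^ n * (real n + 1) ^ 10 + (3 / 4) ^ n * (real n + 1) ^ 10
      + real n / 2 ^ n * (real n + 1) ^ 10) \<longlonglongrightarrow> 0 + 0 + 0"
    by (intro tendsto_add 1 2) (use assms in auto)
  then have "convergent (\<lambda>n. (1 - \<delta>) ^ n * (real n + 1) ^ 10 + (3 / 4) ^ n * (real n + 1) ^ 10
      + real n / 2 ^ n * (real n + 1) ^ 10)" by (rule convergentI)
  from convergent_imp_Bseq[OF this] obtain C where
    "\<And>n. norm ((1 - \<delta>) ^ n * (real n + 1) ^ 10 + (3 / 4) ^ n * (real n + 1) ^ 10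
      + real n / 2 ^ n * (real n + 1) ^ 10) \<le> C" unfolding Bseq_def by blast
  then have "band_decay \<delta> n * (real n + 1) ^ 10 \<le> C" for n
    unfolding band_decay_def distrib_right using abs_le_D1 real_norm_def by metis
  then show thesis by (rule that)
qed

lemma sum_inverse_squares_le: "a \<ge> 1 \<Longrightarrow> (\<Sum>D=a+1..b. 1 / real D ^ 2) \<le> 1"
proof -
  assume a: "a \<ge> 1"
  have "(\<Sum>D=a+1..b. 1 / real D ^ 2) \<le> 1 / real a - 1 / real b" if "b \<ge> a"
    using that
  proof (induction b rule: dec_induct)
    case (step n)
    have "1 / real (Suc n) ^ 2 \<le> 1 / real n - 1 / real (Suc n)"
    proof -
      have n: "real n > 0" using a step(1) by simp
      then have "1 / real n - 1 / real (Suc n) = 1 / (real n * real (Suc n))"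
        by (simp add: field_simps)
      moreover have "1 / real (Suc n) ^ 2 \<le> 1 / (real n * real (Suc n))"
        using n unfolding power2_eq_square by (intro divide_left_mono mult_right_mono) auto
      ultimately show ?thesis by simp
    qed
    then show ?case using step by simp
  qed simp
  moreover have "1 / real a \<le> 1" using a by simp
  moreover have "0 \<le> 1 / real b" by simp
  moreover have "(\<Sum>D=a+1..b. 1 / real D ^ 2) = 0" if "\<not> b \<ge> a" using that by simp
  ultimately show ?thesis by (cases "b \<ge> a") (linarith, simp)
qed

lemma sum_band_decay:
  assumes "0 < \<delta>" "\<delta> < 1"
  obtains K where "K > 0" "\<And>a b. a \<ge> 1 \<Longrightarrow> (\<Sum>D=a+1..b. band_decay \<delta> (block_length D)) \<le> K / real a ^ 3"
proof -
  obtain C where C: "\<And>G. band_decay \<delta> G * (real G + 1) ^ 10 \<le> C"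
    using band_decay_bound[OF assms] by metis
  define K where "K = max 1 (4 ^ 5 * C)"
  show thesis
  proof (rule that[of K])
    show "K > 0" by (simp add: K_def)
    fix a b :: nat assume a: "a \<ge> 1"
    have "band_decay \<delta> (block_length D) \<le> K / real a ^ 3 * (1 / real D ^ 2)" if D: "D \<in> {a+1..b}" for D
    proof -
      define h where "h = band_decay \<delta> (block_length D)"
      have h: "h \<ge> 0" using assms by (simp add: h_def band_decay_def)
      have Dp: "real D > 0" "real a > 0" "real a \<le> real D" using D a by auto
      have "real a ^ 3 * real D ^ 2 \<le> real D ^ 3 * real D ^ 2"
        using Dp by (intro mult_right_mono power_mono) auto
      also have "\<dots> = real D ^ 5" by (simp flip: power_add)
      also have "\<dots> \<le> (4 * (real (block_length D) + 1) ^ 2) ^ 5"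
        using block_length_greater by (intro power_mono) auto
      also have "\<dots> = 4 ^ 5 * (real (block_length D) + 1) ^ 10"
        by (simp add: power_mult_distrib flip: power_mult)
      finally have "h * (real a ^ 3 * real D ^ 2) \<le> h * (4 ^ 5 * (real (block_length D) + 1) ^ 10)"
        using h by (rule mult_left_mono)
      also have "\<dots> \<le> 4 ^ 5 * C" using C[of "block_length D"] by (simp add: h_def)
      also have "\<dots> \<le> K" by (simp add: K_def)
      finally have "h \<le> K / (real a ^ 3 * real D ^ 2)" using Dp by (simp add: pos_le_divide_eq)
      then show ?thesis by (simp add: h_def)
    qed
    then have "(\<Sum>D=a+1..b. band_decay \<delta> (block_length D)) \<le> (\<Sum>D=a+1..b. K / real a ^ 3 * (1 / real D ^ 2))"
      by (rule sum_mono)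
    also have "\<dots> = K / real a ^ 3 * (\<Sum>D=a+1..b. 1 / real D ^ 2)" by (rule sum_distrib_left[symmetric])
    also have "\<dots> \<le> K / real a ^ 3 * 1"
      using sum_inverse_squares_le[OF a] by (intro mult_left_mono) (auto simp: K_def)
    finally show "(\<Sum>D=a+1..b. band_decay \<delta> (block_length D)) \<le> K / real a ^ 3" by simp
  qed
qed

lemma affine_flow_small_dyadic:
  assumes "affine_flow u" "\<eta> > 0"
  obtains m0 where "\<And>m r. m \<ge> m0 \<Longrightarrow> 0 \<le> r \<Longrightarrow> r \<le> 1 / 2 ^ m \<Longrightarrow> norm (u r p - p) \<le> \<eta>"
proof -
  obtain r0 where r0: "r0 > 0" "\<And>r. \<bar>r\<bar> \<le> r0 \<Longrightarrow> norm (u r p - p) \<le> \<eta>"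
    using affine_flow_small[OF assms, of p] by metis
  obtain m0 where m0: "(1/2) ^ m0 < r0" using real_arch_pow_inv[of r0 "1/2"] r0(1) by auto
  show thesis
  proof (rule that[of m0])
    fix m :: nat and r :: real assume m: "m \<ge> m0" "0 \<le> r" "r \<le> 1 / 2 ^ m"
    have "1 / 2 ^ m \<le> (1 / 2 ^ m0 :: real)" using m by (simp add: field_simps)
    then show "norm (u r p - p) \<le> \<eta>" using m m0 by (intro r0(2)) (simp add: power_one_over)
  qed
qed

lemma dyadic_averaging_displacement_le:
  assumes u: "affine_flow u"
    and B: "\<And>s. 0 \<le> s \<Longrightarrow> s \<le> 2 ^ n \<Longrightarrow> norm (u s p - p) \<le> B"
  shows "norm (averaging u (dyadic m (m + n)) p - p) \<le> B"
proof (rule averaging_dist_le[OF u dyadic_nonneg])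
  fix s assume "0 \<le> s" "s \<le> sum_list (dyadic m (m + n))"
  moreover have "sum_list (dyadic m (m + n)) \<le> 2 ^ n"
    using sum_list_dyadic[of m "m + n"] by (simp add: power_add)
  ultimately show "norm (u s p - p) \<le> B" using B by simp
qed

context heisenberg_flows
begin

text \<open>The part of \<open>p\<close> oscillating in the central direction at scales finer than \<open>2 ^ (7 * a)\<close> is
  split into dyadic frequency bands. The band at scale \<open>2 ^ k / 2 ^ m\<close> is damped by about
  \<open>D = m + 8 * a - k\<close> complementary pairs of scales, hence with a summable rate.\<close>
lemma averaging_absorbs_center:
  assumes contr: "\<And>s t q. norm (z (s * t) (half_step x s (half_step y t q)) - half_step x s (half_step y t q))
        \<le> (1 - \<delta>) * norm (z (s * t) q - q) \<or>
      norm (z (s * t) q - q) \<le> (2/3) * norm (z (2 * (s * t)) q - q)"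
    and \<delta>: "0 < \<delta>" "\<delta> \<le> 1 / 9"
    and K: "\<And>a b. a \<ge> 1 \<Longrightarrow> (\<Sum>D=a+1..b. band_decay \<delta> (block_length D)) \<le> K / real a ^ 3"
    and a: "a \<ge> 4"
    and \<Lambda>: "\<And>s. 0 \<le> s \<Longrightarrow> s \<le> 2 ^ (8 * a) \<Longrightarrow> norm (z s p - p) \<le> \<Lambda>"
    and \<eta>: "\<eta> > 0"
  obtains m0 where "\<And>m. m \<ge> m0 \<Longrightarrow>
    norm (averaging x (dyadic m (m + 4 * a)) (averaging y (dyadic m (m + 4 * a)) p)
      - averaging x (dyadic m (m + 4 * a)) (averaging y (dyadic m (m + 4 * a)) (averaging z (dyadic m (m + 7 * a)) p)))
    \<le> K / real a ^ 3 * \<Lambda> + \<eta>"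
proof -
  have L0: "\<Lambda> \<ge> 0" using order_trans[OF norm_ge_zero \<Lambda>[of 0]] by simp
  obtain m' where m': "\<And>m r. m \<ge> m' \<Longrightarrow> 0 \<le> r \<Longrightarrow> r \<le> 1 / 2 ^ m \<Longrightarrow> norm (z r p - p) \<le> \<eta> / 2"
    using affine_flow_small_dyadic[OF z, of "\<eta> / 2" p] \<eta> by auto
  \<comment> \<open>There will be \<open>m' + 7 * a\<close> bands with block lengths at most
    \<open>m' + 8 * a\<close>, whatever \<open>m\<close> is. Hence the error \<open>\<omega>\<close>
    from the resolution can be fixed before \<open>m\<close>, so that its total stays below
    \<open>\<eta>\<close>.\<close>
  define N where "N = (real m' + 7 * real a) * (real m' + 8 * real a)"
  have N: "N > 0" using a by (simp add: N_def)
  define \<omega> where "\<omega> = \<eta> / N"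
  have \<omega>: "\<omega> > 0" using N \<eta> by (simp add: \<omega>_def)
  obtain m1 where m1: "\<And>m r. m \<ge> m1 \<Longrightarrow> 0 \<le> r \<Longrightarrow> r \<le> 1 / 2 ^ m \<Longrightarrow> norm (z r p - p) \<le> \<omega>"
    using affine_flow_small_dyadic[OF z \<omega>, of p] by metis
  show thesis
  proof (rule that[of "max m1 (m' + 4 * a)"])
    fix m assume m: "m \<ge> max m1 (m' + 4 * a)"
    define A where "A k = averaging x (dyadic m (m + 4 * a)) (averaging y (dyadic m (m + 4 * a))
      (averaging z (dyadic m k) p))" for k
    define P where "P = averaging x (dyadic m (m + 4 * a)) (averaging y (dyadic m (m + 4 * a)) p)"
    \<comment> \<open>Central averaging up to this index involves only times up to
      \<open>1 / 2 ^ m'\<close>, which move \<open>p\<close> by at most \<open>\<eta> / 2\<close>;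
      the bands are counted from here on.\<close>
    define k0 where "k0 = m - m'"
    have k0: "k0 + m' = m" "k0 \<ge> 4 * a" using m by (auto simp: k0_def)
    have "norm (A k0 - P) \<le> norm (averaging z (dyadic m k0) p - p)"
      unfolding A_def P_def using averaging_nonexp[OF x] averaging_nonexp[OF y] order_trans by blast
    also have "\<dots> \<le> \<eta> / 2"
    proof (rule averaging_dist_le[OF z dyadic_nonneg])
      fix s assume s: "0 \<le> s" "s \<le> sum_list (dyadic m k0)"
      have "sum_list (dyadic m k0) \<le> 2 ^ k0 / 2 ^ m" by (rule sum_list_dyadic)
      also have "\<dots> = 1 / 2 ^ m'" unfolding k0(1)[symmetric] by (simp add: power_add)
      finally show "norm (z s p - p) \<le> \<eta> / 2" using s m'[of m' s] by simp
    qed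
    finally have 1: "norm (A k0 - P) \<le> \<eta> / 2" .
    have band: "norm (z (2 ^ k / 2 ^ m) (A k) - A k) \<le> band_decay \<delta> (block_length (m + 8 * a - k)) * \<Lambda>
        + (real m' + 8 * real a) * \<omega>" if k: "k \<in> {k0..<m + 7 * a}" for k
    proof -
      define D where "D = m + 8 * a - k"
      define G where "G = block_length D"
      have D: "D + k = m + 8 * a" "D > a" "D \<le> m' + 8 * a" using k k0 by (auto simp: D_def)
      have G: "4 * G * G \<le> D" unfolding G_def by (rule block_length_le)
      have G0: "G > 0" unfolding G_def using D a by (intro block_length_pos) simp
      have GD: "G \<le> D"
      proof -
        have "G * 1 \<le> G * (4 * G)" using G0 by (intro mult_le_mono2) simp
        also have "G * (4 * G) = 4 * G * G" by simp
        also note G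
        finally show ?thesis by (simp only: mult_1_right)
      qed
      have "norm (z (2 ^ k / 2 ^ m) (A k) - A k) \<le> ((1 - \<delta>) ^ G + (3 / 4) ^ G) * \<Lambda> + G * (\<Lambda> / 2 ^ G + \<omega>)"
        unfolding A_def
      proof (rule dyadic_band_displacement_le[OF contr \<delta> G0])
        show "4 * a \<le> Suc k" "4 * a > 0" using k k0 a by auto
        show "2 * G * G + k + 1 \<le> m + 2 * (4 * a)" using G D a by linarith
        show "2 * G * G + 1 \<le> m + 4 * a" using G D a m by linarith
      next
        fix j assume "j \<le> G"
        then have "k + j \<le> m + 8 * a" using GD D by linarith
        then have "(2::real) ^ (k + j) \<le> 2 ^ (m + 8 * a)" by (intro power_increasing) auto
        then have "2 ^ k / 2 ^ m * 2 ^ j \<le> (2::real) ^ (8 * a)" by (simp add: power_add field_simps)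
        then show "norm (z (2 ^ k / 2 ^ m * 2 ^ j) (averaging z (dyadic m k) p) - averaging z (dyadic m k) p) \<le> \<Lambda>"
          using \<Lambda> by (intro order_trans[OF displacement_averaging_le[OF affine_flowD(1)[OF z] _ z]])
            (auto simp: affine_flowD[OF z] add.commute)
      next
        fix r :: real assume r: "0 \<le> r" "r \<le> 2 ^ k / 2 ^ m / 2 ^ G"
        have k8: "2 ^ k / 2 ^ m \<le> (2::real) ^ (8 * a)"
        proof -
          have "(2::real) ^ k \<le> 2 ^ (m + 8 * a)" using D by (intro power_increasing) auto
          then show ?thesis by (simp add: power_add field_simps)
        qed
        \<comment> \<open>Central averaging up to scale \<open>2 ^ k / 2 ^ m\<close> has smoothed
          the point, so a parameter smaller by \<open>2 ^ G\<close> displaces it by only about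
          \<open>\<Lambda> / 2 ^ G\<close>. This yields the term \<open>G / 2 ^ G\<close> of
          \<open>band_decay\<close>.\<close>
        have "norm (z r (averaging z (dyadic m k) p) - averaging z (dyadic m k) p)
          \<le> r / (2 ^ k / 2 ^ m) * norm (z (2 ^ k / 2 ^ m) p - p) + \<omega>"
          by (rule smoothing[OF z r(1)]) (use m1[of m] m in auto)
        also have "r / (2 ^ k / 2 ^ m) * norm (z (2 ^ k / 2 ^ m) p - p) \<le> 1 / 2 ^ G * \<Lambda>"
          using r k8 by (intro mult_mono \<Lambda>) (auto simp: field_simps)
        finally show "norm (z r (averaging z (dyadic m k) p) - averaging z (dyadic m k) p) \<le> \<Lambda> / 2 ^ G + \<omega>"
          by simp
      qed
      also have "\<dots> = band_decay \<delta> G * \<Lambda> + real G * \<omega>"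
        by (simp add: band_decay_def algebra_simps)
      also have "real G * \<omega> \<le> (real m' + 8 * real a) * \<omega>"
      proof (rule mult_right_mono)
        have "real G \<le> real (m' + 8 * a)" using GD D by (simp only: of_nat_le_iff)
        then show "real G \<le> real m' + 8 * real a" by simp
      qed (use \<omega> in simp)
      finally show ?thesis by (simp add: G_def D_def)
    qed
    have "norm (A (m + 7 * a) - A k0) \<le> (\<Sum>k=k0..<m + 7 * a. norm (z (2 ^ k / 2 ^ m) (A k) - A k) / 2)"
      unfolding A_def by (rule averaging_center_telescope) (use k0 in simp)
    also have "\<dots> \<le> (\<Sum>k=k0..<m + 7 * a. band_decay \<delta> (block_length (m + 8 * a - k)) * \<Lambda>
        + (real m' + 8 * real a) * \<omega> / 2)"
    proof (rule sum_mono)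
      fix k assume k: "k \<in> {k0..<m + 7 * a}"
      have "0 \<le> band_decay \<delta> (block_length (m + 8 * a - k)) * \<Lambda>"
        using \<delta> L0 by (simp add: band_decay_def)
      then show "norm (z (2 ^ k / 2 ^ m) (A k) - A k) / 2 \<le> band_decay \<delta> (block_length (m + 8 * a - k)) * \<Lambda>
        + (real m' + 8 * real a) * \<omega> / 2" using band[OF k] by simp
    qed
    also have "\<dots> = (\<Sum>k=k0..<m + 7 * a. band_decay \<delta> (block_length (m + 8 * a - k))) * \<Lambda>
        + real (m + 7 * a - k0) * ((real m' + 8 * real a) * \<omega> / 2)"
      by (simp add: sum.distrib sum_distrib_right)
    also have "(\<Sum>k=k0..<m + 7 * a. band_decay \<delta> (block_length (m + 8 * a - k)))
        = (\<Sum>D=a+1..m'+8*a. band_decay \<delta> (block_length D))"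
      by (rule sum.reindex_bij_witness[where i = "\<lambda>D. m + 8 * a - D" and j = "\<lambda>k. m + 8 * a - k"])
        (use k0 in auto)
    also have "(\<Sum>D=a+1..m'+8*a. band_decay \<delta> (block_length D)) * \<Lambda> \<le> K / real a ^ 3 * \<Lambda>"
      using K[of a "m' + 8 * a"] a L0 by (intro mult_right_mono) auto
    also have "real (m + 7 * a - k0) * ((real m' + 8 * real a) * \<omega> / 2) = N * \<omega> / 2"
    proof -
      have "m + 7 * a - k0 = m' + 7 * a" using k0 by simp
      then show ?thesis by (simp add: N_def)
    qed
    also have "N * \<omega> = \<eta>" using N by (simp add: \<omega>_def)
    finally have 2: "norm (A (m + 7 * a) - A k0) \<le> K / real a ^ 3 * \<Lambda> + \<eta> / 2" by simp
    have "norm (P - A (m + 7 * a)) \<le> norm (A (m + 7 * a) - A k0) + norm (A k0 - P)"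
      using norm_triangle_ineq[of "A (m + 7 * a) - A k0" "A k0 - P"] by (simp add: norm_minus_commute)
    also have "\<dots> \<le> K / real a ^ 3 * \<Lambda> + \<eta>" using 1 2 by simp
    finally show "norm (averaging x (dyadic m (m + 4 * a)) (averaging y (dyadic m (m + 4 * a)) p)
      - averaging x (dyadic m (m + 4 * a)) (averaging y (dyadic m (m + 4 * a)) (averaging z (dyadic m (m + 7 * a)) p)))
    \<le> K / real a ^ 3 * \<Lambda> + \<eta>" unfolding P_def A_def .
  qed
qed

text \<open>The point \<open>q\<close> is within \<open>\<epsilon>\<close> of the average of the
  centrally smoothed point \<open>Zp\<close>. For \<open>z\<close>, the smoothing passes through the
  central averages; for \<open>x\<close>, the outer average smooths; for \<open>y\<close>, the time
  \<open>s\<close> is first moved past the average over \<open>x\<close> at a small central cost,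
  then the inner average smooths.\<close>

lemma averaging_almost_invariant:
  assumes absorb: "norm (averaging x (dyadic m (m + 4 * a)) (averaging y (dyadic m (m + 4 * a)) p)
      - averaging x (dyadic m (m + 4 * a)) (averaging y (dyadic m (m + 4 * a)) (averaging z (dyadic m (m + 7 * a)) p)))
    \<le> \<epsilon>"
    and \<Lambda>: "\<And>s. 0 \<le> s \<Longrightarrow> s \<le> 2 ^ (8 * a) \<Longrightarrow> norm (x s p - p) \<le> \<Lambda>"
       "\<And>s. 0 \<le> s \<Longrightarrow> s \<le> 2 ^ (8 * a) \<Longrightarrow> norm (y s p - p) \<le> \<Lambda>"
       "\<And>s. 0 \<le> s \<Longrightarrow> s \<le> 2 ^ (8 * a) \<Longrightarrow> norm (z s p - p) \<le> \<Lambda>"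
    and \<omega>: "\<And>r. 0 \<le> r \<Longrightarrow> r \<le> 1 / 2 ^ m \<Longrightarrow> norm (x r p - p) \<le> \<omega>"
       "\<And>r. 0 \<le> r \<Longrightarrow> r \<le> 1 / 2 ^ m \<Longrightarrow> norm (y r p - p) \<le> \<omega>"
       "\<And>r. 0 \<le> r \<Longrightarrow> r \<le> 1 / 2 ^ m * 2 ^ (4 * a) \<Longrightarrow> norm (z r p - p) \<le> \<omega>"
    and s: "0 \<le> s" "s \<le> 2 ^ (2 * a)"
  defines "q \<equiv> averaging x (dyadic m (m + 4 * a)) (averaging y (dyadic m (m + 4 * a)) p)"
  shows "norm (x s q - q) \<le> 2 * \<epsilon> + 3 * \<Lambda> / 2 ^ a + 2 * \<omega>"
    and "norm (y s q - q) \<le> 2 * \<epsilon> + 3 * \<Lambda> / 2 ^ a + 2 * \<omega>"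
    and "norm (z s q - q) \<le> 2 * \<epsilon> + 3 * \<Lambda> / 2 ^ a + 2 * \<omega>"
proof -
  define X where "X = averaging x (dyadic m (m + 4 * a))"
  define Y where "Y = averaging y (dyadic m (m + 4 * a))"
  define Zp where "Zp = averaging z (dyadic m (m + 7 * a)) p"
  have L0: "\<Lambda> \<ge> 0" using order_trans[OF norm_ge_zero \<Lambda>(1)[of 0]] by simp
  have w0: "\<omega> \<ge> 0" using order_trans[OF norm_ge_zero \<omega>(1)[of 0]] by simp
  have e0: "\<epsilon> \<ge> 0" using order_trans[OF norm_ge_zero absorb] .
  have \<omega>z: "norm (z r p - p) \<le> \<omega>" if "0 \<le> r" "r \<le> 1 / 2 ^ m" for r
  proof (rule \<omega>(3)[OF that(1)])
    have "1 / 2 ^ m * 1 \<le> (1 / 2 ^ m * 2 ^ (4 * a) :: real)" by (intro mult_left_mono) auto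
    then show "r \<le> 1 / 2 ^ m * 2 ^ (4 * a)" using that by simp
  qed
  have pow: "(2::real) ^ i \<le> 2 ^ j" if "i \<le> j" for i j :: nat using that by (intro power_increasing) auto
  have q: "q = X (Y p)" by (simp add: q_def X_def Y_def)
  have close: "norm (q - X (Y Zp)) \<le> \<epsilon>" using absorb by (simp add: q X_def Y_def Zp_def)
  have Zs: "norm (z r Zp - Zp) \<le> \<Lambda> / 2 ^ a + \<omega>" if r: "0 \<le> r" "r \<le> 2 ^ (6 * a)" for r
  proof -
    have "norm (z r Zp - Zp) \<le> r / (2 ^ (m + 7 * a) / 2 ^ m) * norm (z (2 ^ (m + 7 * a) / 2 ^ m) p - p) + \<omega>"
      unfolding Zp_def by (rule smoothing[OF z r(1) \<omega>z])
    also have "(2::real) ^ (m + 7 * a) / 2 ^ m = 2 ^ (7 * a)" by (simp add: power_add)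
    also have "r / 2 ^ (7 * a) * norm (z (2 ^ (7 * a)) p - p) \<le> 2 ^ (6 * a) / 2 ^ (7 * a) * \<Lambda>"
      using r pow[of "7 * a" "8 * a"] by (intro mult_mono divide_right_mono \<Lambda>) auto
    also have "(2::real) ^ (6 * a) / 2 ^ (7 * a) = 1 / 2 ^ a"
    proof -
      have "(2::real) ^ (7 * a) = 2 ^ (6 * a) * 2 ^ a" by (simp flip: power_add)
      then show ?thesis by simp
    qed
    finally show ?thesis by simp
  qed
  have s6: "s \<le> 2 ^ (6 * a)" by (rule order_trans[OF s(2) pow]) simp
  have tri: "norm (T q - q) \<le> 2 * \<epsilon> + norm (T (X (Y Zp)) - X (Y Zp))" if "affine_isometry T" for T
  proof -
    have "T q - q = (T q - T (X (Y Zp))) + (T (X (Y Zp)) - X (Y Zp)) - (q - X (Y Zp))" by simp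
    then have "norm (T q - q) \<le> norm (T q - T (X (Y Zp))) + norm (T (X (Y Zp)) - X (Y Zp)) + norm (q - X (Y Zp))"
      by (smt (verit) norm_triangle_ineq norm_triangle_ineq4)
    then show ?thesis using close affine_isometry_dist[OF that] by simp
  qed
  show "norm (z s q - q) \<le> 2 * \<epsilon> + 3 * \<Lambda> / 2 ^ a + 2 * \<omega>"
  proof -
    have "norm (z s (X (Y Zp)) - X (Y Zp)) \<le> norm (z s Zp - Zp)"
      unfolding X_def Y_def using center_displacement_x center_displacement_y order_trans by blast
    also have "\<dots> \<le> \<Lambda> / 2 ^ a + \<omega>" by (rule Zs[OF s(1) s6])
    also have "\<Lambda> / 2 ^ a \<le> 3 * \<Lambda> / 2 ^ a" using L0 by (intro divide_right_mono) auto
    finally show ?thesis using tri[OF affine_flowD(1)[OF z, of s]] w0 by linarith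
  qed
  have pow4: "(2::real) ^ (m + 4 * a) / 2 ^ m = 2 ^ (4 * a)" by (simp add: power_add)
  have s4: "s / 2 ^ (4 * a) \<le> 1 / 2 ^ a"
  proof -
    have "s / 2 ^ (4 * a) \<le> 2 ^ (3 * a) / 2 ^ (4 * a)"
      by (intro divide_right_mono order_trans[OF s(2) pow]) auto
    moreover have "(2::real) ^ (4 * a) = 2 ^ (3 * a) * 2 ^ a" by (simp flip: power_add)
    ultimately show ?thesis by simp
  qed
  show "norm (x s q - q) \<le> 2 * \<epsilon> + 3 * \<Lambda> / 2 ^ a + 2 * \<omega>"
  proof -
    \<comment> \<open>Smoothing in the direction of \<open>x\<close> requires continuity at the
      inner point \<open>Y p\<close>. Moving a time below \<open>1 / 2 ^ m\<close> past
      \<open>Y\<close> costs central parameters up to \<open>2 ^ (4 * a) / 2 ^ m\<close>, whence the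
      wider range in the third hypothesis on \<open>\<omega>\<close>.\<close>
    interpret fl: heisenberg_flows y x "\<lambda>r. z (- r)" by (rule flipped)
    have \<omega>Y: "norm (x r (Y p) - Y p) \<le> 2 * \<omega>" if r: "0 \<le> r" "r \<le> 1 / 2 ^ m" for r
    proof -
      have "norm (x r (Y p) - Y (x r p)) \<le> \<omega>" unfolding Y_def
      proof (rule fl.averaging_almost_commute[OF dyadic_nonneg r(1)])
        fix r' assume r': "0 \<le> r'" "r' \<le> r * sum_list (dyadic m (m + 4 * a))"
        note r'(2)
        also have "r * sum_list (dyadic m (m + 4 * a)) \<le> r * 2 ^ (4 * a)"
          using sum_list_dyadic[of m "m + 4 * a"] r unfolding pow4 by (intro mult_left_mono)
        also have "\<dots> \<le> 1 / 2 ^ m * 2 ^ (4 * a)" using r by (intro mult_right_mono) auto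
        finally show "norm (z (- r') p - p) \<le> \<omega>"
          unfolding flow_displacement_minus[OF z] using r' by (intro \<omega>(3))
      qed
      moreover have "norm (Y (x r p) - Y p) \<le> \<omega>"
        unfolding Y_def using averaging_nonexp[OF y] \<omega>(1)[OF r] order_trans by blast
      ultimately show ?thesis using norm_triangle_ineq[of "x r (Y p) - Y (x r p)" "Y (x r p) - Y p"] by simp
    qed
    have Yp: "norm (Y p - p) \<le> \<Lambda>"
      unfolding Y_def
      by (rule dyadic_averaging_displacement_le[OF y], rule \<Lambda>(2), assumption, erule order_trans[OF _ pow], simp)
    have "norm (x (2 ^ (4 * a)) (Y p) - Y p) \<le> norm (x (2 ^ (4 * a)) (Y p) - x (2 ^ (4 * a)) p)
        + norm (x (2 ^ (4 * a)) p - p) + norm (Y p - p)"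
      by (smt (verit) norm_diff_triangle_ineq norm_triangle_ineq norm_triangle_ineq4 diff_add_cancel
          add_diff_cancel diff_diff_eq2)
    also have "\<dots> \<le> 3 * \<Lambda>"
      using Yp \<Lambda>(1)[of "2 ^ (4 * a)"] pow[of "4 * a" "8 * a"] by (simp add: affine_flowD(4)[OF x])
    finally have xY: "norm (x (2 ^ (4 * a)) (Y p) - Y p) \<le> 3 * \<Lambda>" .
    have "norm (x s q - q) \<le> s / (2 ^ (m + 4 * a) / 2 ^ m) * norm (x (2 ^ (m + 4 * a) / 2 ^ m) (Y p) - Y p) + 2 * \<omega>"
      unfolding q X_def by (rule smoothing[OF x s(1) \<omega>Y])
    also have "s / (2 ^ (m + 4 * a) / 2 ^ m) * norm (x (2 ^ (m + 4 * a) / 2 ^ m) (Y p) - Y p) \<le> 1 / 2 ^ a * (3 * \<Lambda>)"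
      unfolding pow4 using s4 xY by (intro mult_mono) auto
    finally show ?thesis using e0 by simp
  qed
  show "norm (y s q - q) \<le> 2 * \<epsilon> + 3 * \<Lambda> / 2 ^ a + 2 * \<omega>"
  proof -
    have "norm (y s (X (Y Zp)) - X (y s (Y Zp))) \<le> \<Lambda> / 2 ^ a + \<omega>" unfolding X_def
    proof (rule averaging_almost_commute[OF dyadic_nonneg s(1)])
      fix r assume r: "0 \<le> r" "r \<le> s * sum_list (dyadic m (m + 4 * a))"
      note r(2)
      \<comment> \<open>These parameters reach \<open>2 ^ (6 * a)\<close>; averaging
        \<open>z\<close> up to \<open>2 ^ (7 * a)\<close> leaves the spare factor
        \<open>2 ^ a\<close>.\<close>
      also have "s * sum_list (dyadic m (m + 4 * a)) \<le> 2 ^ (2 * a) * 2 ^ (4 * a)"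
      proof (rule mult_mono)
        show "sum_list (dyadic m (m + 4 * a)) \<le> 2 ^ (4 * a)"
          using sum_list_dyadic[of m "m + 4 * a"] unfolding pow4 .
        show "0 \<le> sum_list (dyadic m (m + 4 * a))" by (rule sum_list_nonneg) (rule dyadic_nonneg)
      qed (use s in auto)
      also have "\<dots> = 2 ^ (6 * a)" by (simp flip: power_add)
      finally have "norm (z r Zp - Zp) \<le> \<Lambda> / 2 ^ a + \<omega>" by (rule Zs[OF r(1)])
      then show "norm (z r (Y Zp) - Y Zp) \<le> \<Lambda> / 2 ^ a + \<omega>"
        unfolding Y_def using center_displacement_y order_trans by blast
    qed
    moreover have "norm (X (y s (Y Zp)) - X (Y Zp)) \<le> \<Lambda> / 2 ^ a + \<omega>"
    proof -
      have Zy: "norm (y r Zp - Zp) \<le> norm (y r p - p)" for r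
        unfolding Zp_def by (rule displacement_averaging_le[OF affine_flowD(1)[OF y] _ z]) (simp add: zy)
      have "norm (X (y s (Y Zp)) - X (Y Zp)) \<le> norm (y s (Y Zp) - Y Zp)"
        unfolding X_def by (rule averaging_nonexp[OF x])
      also have "\<dots> \<le> s / (2 ^ (m + 4 * a) / 2 ^ m) * norm (y (2 ^ (m + 4 * a) / 2 ^ m) Zp - Zp) + \<omega>"
        unfolding Y_def by (rule smoothing[OF y s(1)]) (use Zy \<omega>(2) order_trans in blast)
      also have "s / (2 ^ (m + 4 * a) / 2 ^ m) * norm (y (2 ^ (m + 4 * a) / 2 ^ m) Zp - Zp) \<le> 1 / 2 ^ a * \<Lambda>"
        unfolding pow4 using s4 order_trans[OF Zy \<Lambda>(2)[of "2 ^ (4 * a)"]] pow[of "4 * a" "8 * a"]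
        by (intro mult_mono) auto
      finally show ?thesis by simp
    qed
    ultimately have "norm (y s (X (Y Zp)) - X (Y Zp)) \<le> 2 * (\<Lambda> / 2 ^ a) + 2 * \<omega>"
      using norm_triangle_ineq[of "y s (X (Y Zp)) - X (y s (Y Zp))" "X (y s (Y Zp)) - X (Y Zp)"] by simp
    also have "2 * (\<Lambda> / 2 ^ a) \<le> 3 * \<Lambda> / 2 ^ a" using L0 by (simp add: divide_right_mono)
    finally show ?thesis using tri[OF affine_flowD(1)[OF y, of s]] by linarith
  qed
qed

end

text \<open>\<open>K\<close> depends on the space only, while \<open>m0\<close> also depends on the
  point, through continuity of its orbits. The error \<open>1 / 2 ^ a\<close> from smoothing is
  absorbed into the cubic rate.\<close>

theorem heisenberg_averaging:
  assumes "uniformly_convex TYPE('a::real_normed_vector)"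
  obtains K where "K > 0"
    "\<And>x y z a \<Lambda> \<eta>. \<And>p::'a. heisenberg_flows x y z \<Longrightarrow> a \<ge> 4 \<Longrightarrow> \<eta> > 0 \<Longrightarrow>
      (\<And>s. 0 \<le> s \<Longrightarrow> s \<le> 2 ^ (8 * a) \<Longrightarrow> norm (x s p - p) \<le> \<Lambda>) \<Longrightarrow>
      (\<And>s. 0 \<le> s \<Longrightarrow> s \<le> 2 ^ (8 * a) \<Longrightarrow> norm (y s p - p) \<le> \<Lambda>) \<Longrightarrow>
      (\<And>s. 0 \<le> s \<Longrightarrow> s \<le> 2 ^ (8 * a) \<Longrightarrow> norm (z s p - p) \<le> \<Lambda>) \<Longrightarrow>
      \<exists>m0. \<forall>m\<ge>m0. \<forall>s. 0 \<le> s \<and> s \<le> 2 ^ (2 * a) \<longrightarrow>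
        (let q = averaging x (dyadic m (m + 4 * a)) (averaging y (dyadic m (m + 4 * a)) p) in
          norm (x s q - q) \<le> K / real a ^ 3 * \<Lambda> + \<eta> \<and> norm (y s q - q) \<le> K / real a ^ 3 * \<Lambda> + \<eta> \<and>
          norm (z s q - q) \<le> K / real a ^ 3 * \<Lambda> + \<eta>)"
proof -
  obtain \<delta> where \<delta>: "0 < \<delta>" "\<delta> \<le> 1 / 9"
    and contr: "\<And>x y z s t. \<And>q::'a. heisenberg_flows x y z \<Longrightarrow>
      norm (z (s * t) (half_step x s (half_step y t q)) - half_step x s (half_step y t q))
        \<le> (1 - \<delta>) * norm (z (s * t) q - q) \<or>
      norm (z (s * t) q - q) \<le> (2/3) * norm (z (2 * (s * t)) q - q)"
    using heisenberg_contraction[OF assms] by blast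
  obtain K where K: "K > 0"
    "\<And>a b. a \<ge> 1 \<Longrightarrow> (\<Sum>D=a+1..b. band_decay \<delta> (block_length D)) \<le> K / real a ^ 3"
    using sum_band_decay[of \<delta>] \<delta> by auto
  have "(\<lambda>n::nat. real n ^ 3 / 2 ^ n) \<longlonglongrightarrow> 0" by real_asymp
  from convergent_imp_Bseq[OF convergentI[OF this]] obtain C where
    C: "C > 0" "\<And>n. norm (real n ^ 3 / 2 ^ n) \<le> C" unfolding Bseq_def by blast
  have C': "1 / 2 ^ a \<le> C / real a ^ 3" if "a \<ge> 4" for a
    using C(2)[of a] that by (simp add: field_simps)
  show thesis
  proof (rule that[of "2 * K + 3 * C"])
    show "2 * K + 3 * C > 0" using K C by simp
    fix x y z :: "real \<Rightarrow> 'a \<Rightarrow> 'a" and a :: nat and \<Lambda> \<eta> :: real and p :: 'a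
    assume "heisenberg_flows x y z" and a: "a \<ge> 4" and \<eta>: "\<eta> > 0"
      and \<Lambda>: "\<And>s. 0 \<le> s \<Longrightarrow> s \<le> 2 ^ (8 * a) \<Longrightarrow> norm (x s p - p) \<le> \<Lambda>"
       "\<And>s. 0 \<le> s \<Longrightarrow> s \<le> 2 ^ (8 * a) \<Longrightarrow> norm (y s p - p) \<le> \<Lambda>"
       "\<And>s. 0 \<le> s \<Longrightarrow> s \<le> 2 ^ (8 * a) \<Longrightarrow> norm (z s p - p) \<le> \<Lambda>"
    then interpret heisenberg_flows x y z by simp
    have L0: "\<Lambda> \<ge> 0" using order_trans[OF norm_ge_zero \<Lambda>(1)[of 0]] by simp
    have \<eta>4: "\<eta> / 4 > 0" using \<eta> by simp
    obtain m1 where m1: "\<And>m. m \<ge> m1 \<Longrightarrow>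
      norm (averaging x (dyadic m (m + 4 * a)) (averaging y (dyadic m (m + 4 * a)) p)
      - averaging x (dyadic m (m + 4 * a)) (averaging y (dyadic m (m + 4 * a)) (averaging z (dyadic m (m + 7 * a)) p)))
      \<le> K / real a ^ 3 * \<Lambda> + \<eta> / 4"
      using averaging_absorbs_center[OF contr \<delta> K(2) a \<Lambda>(3) \<eta>4] heisenberg_flows_axioms by blast
    obtain mx where mx: "\<And>m r. m \<ge> mx \<Longrightarrow> 0 \<le> r \<Longrightarrow> r \<le> 1 / 2 ^ m \<Longrightarrow> norm (x r p - p) \<le> \<eta> / 4"
      using affine_flow_small_dyadic[OF x \<eta>4, of p] by metis
    obtain my where my: "\<And>m r. m \<ge> my \<Longrightarrow> 0 \<le> r \<Longrightarrow> r \<le> 1 / 2 ^ m \<Longrightarrow> norm (y r p - p) \<le> \<eta> / 4"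
      using affine_flow_small_dyadic[OF y \<eta>4, of p] by metis
    obtain mz where mz: "\<And>m r. m \<ge> mz \<Longrightarrow> 0 \<le> r \<Longrightarrow> r \<le> 1 / 2 ^ m \<Longrightarrow> norm (z r p - p) \<le> \<eta> / 4"
      using affine_flow_small_dyadic[OF z \<eta>4, of p] by metis
    show "\<exists>m0. \<forall>m\<ge>m0. \<forall>s. 0 \<le> s \<and> s \<le> 2 ^ (2 * a) \<longrightarrow>
        (let q = averaging x (dyadic m (m + 4 * a)) (averaging y (dyadic m (m + 4 * a)) p) in
          norm (x s q - q) \<le> (2 * K + 3 * C) / real a ^ 3 * \<Lambda> + \<eta> \<and>
          norm (y s q - q) \<le> (2 * K + 3 * C) / real a ^ 3 * \<Lambda> + \<eta> \<and>
          norm (z s q - q) \<le> (2 * K + 3 * C) / real a ^ 3 * \<Lambda> + \<eta>)"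
    proof (intro exI[of _ "Max {m1, mx, my, mz + 4 * a}"] allI impI)
      fix m s assume m: "m \<ge> Max {m1, mx, my, mz + 4 * a}" and s: "0 \<le> s \<and> s \<le> (2::real) ^ (2 * a)"
      have "norm (z r p - p) \<le> \<eta> / 4" if r: "0 \<le> r" "r \<le> 1 / 2 ^ m * 2 ^ (4 * a)" for r
      \<comment> \<open>The central time is longer by \<open>2 ^ (4 * a)\<close>, so the resolution
        is lowered by \<open>4 * a\<close>; this explains \<open>mz + 4 * a\<close> in the
        maximum.\<close>
      proof (rule mz[of "m - 4 * a"])
        have "(2::real) ^ m = 2 ^ (m - 4 * a) * 2 ^ (4 * a)" using m by (simp flip: power_add)
        then show "r \<le> 1 / 2 ^ (m - 4 * a)" using r by simp
      qed (use m r in auto)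
      note inv = averaging_almost_invariant[OF m1 \<Lambda> mx my this]
      have b: "2 * (K / real a ^ 3 * \<Lambda> + \<eta> / 4) + 3 * \<Lambda> / 2 ^ a + 2 * (\<eta> / 4)
          \<le> (2 * K + 3 * C) / real a ^ 3 * \<Lambda> + \<eta>"
      proof -
        have "3 * \<Lambda> / 2 ^ a \<le> 3 * C / real a ^ 3 * \<Lambda>"
          using mult_right_mono[OF C'[OF a], of "3 * \<Lambda>"] L0 by (simp add: mult.commute mult.left_commute)
        moreover have "(2 * K + 3 * C) / real a ^ 3 * \<Lambda> = 2 * (K / real a ^ 3 * \<Lambda>) + 3 * C / real a ^ 3 * \<Lambda>"
          by (simp add: add_divide_distrib distrib_right)
        ultimately show ?thesis by simp
      qed
      show "let q = averaging x (dyadic m (m + 4 * a)) (averaging y (dyadic m (m + 4 * a)) p) in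
          norm (x s q - q) \<le> (2 * K + 3 * C) / real a ^ 3 * \<Lambda> + \<eta> \<and>
          norm (y s q - q) \<le> (2 * K + 3 * C) / real a ^ 3 * \<Lambda> + \<eta> \<and>
          norm (z s q - q) \<le> (2 * K + 3 * C) / real a ^ 3 * \<Lambda> + \<eta>"
        unfolding Let_def using m s by (intro conjI order_trans[OF inv(1) b] order_trans[OF inv(2) b] order_trans[OF inv(3) b]) auto
    qed
  qed
qed

section \<open>Root subgroups of SL3\<close>

definition elementary :: "3 \<Rightarrow> 3 \<Rightarrow> real \<Rightarrow> real^3^3" where
  "elementary i j s = (\<chi> k l. if k = l then 1 else if k = i \<and> l = j then s else 0)"

lemma elementary_mult_left:
  assumes "i \<noteq> j"
  shows "(elementary i j s ** A) $ k $ l = A $ k $ l + (if k = i then s * A $ j $ l else 0)"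
  using assms exhaust_3[of i] exhaust_3[of j] exhaust_3[of k]
  by (auto simp: elementary_def matrix_matrix_mult_def sum_3)

lemma elementary_mult_right:
  assumes "i \<noteq> j"
  shows "(A ** elementary i j s) $ k $ l = A $ k $ l + (if l = j then A $ k $ i * s else 0)"
  using assms exhaust_3[of i] exhaust_3[of j] exhaust_3[of l]
  by (auto simp: elementary_def matrix_matrix_mult_def sum_3)

lemma elementary_add:
  assumes "i \<noteq> j" shows "elementary i j (s + t) = elementary i j s ** elementary i j t"
  using assms unfolding vec_eq_iff elementary_mult_left[OF assms] by (auto simp: elementary_def)

lemma elementary_0: "elementary i j 0 = mat 1"
  by (simp add: elementary_def mat_def vec_eq_iff)

lemma elementary_commute:
  assumes "i \<noteq> j" "k \<noteq> l" "j \<noteq> k" "i \<noteq> l"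
  shows "elementary i j s ** elementary k l t = elementary k l t ** elementary i j s"
  using assms
  unfolding vec_eq_iff elementary_mult_left[OF assms(1)] elementary_mult_left[OF assms(2)]
  by (auto simp: elementary_def)

lemma elementary_commutator:
  assumes "i \<noteq> j" "j \<noteq> k" "i \<noteq> k"
  shows "elementary i j s ** elementary j k t =
    elementary i k (s * t) ** (elementary j k t ** elementary i j s)"
  using assms
  unfolding vec_eq_iff elementary_mult_left[OF assms(1)] elementary_mult_left[OF assms(2)]
    elementary_mult_left[OF assms(3)]
  by (auto simp: elementary_def)

lemma det_elementary: "i \<noteq> j \<Longrightarrow> det (elementary i j s) = 1"
  using exhaust_3[of i] exhaust_3[of j] by (auto simp: det_3 elementary_def)

lemma elementary_SL3: "i \<noteq> j \<Longrightarrow> elementary i j s \<in> SL3"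
  by (simp add: SL3_def det_elementary)

text \<open>Gaussian elimination: inverses of elementary matrices are elementary, so membership in
  \<open>S\<close> can be tested after row and column operations.\<close>

lemma SL3_generated:
  assumes el: "\<And>i j s. i \<noteq> j \<Longrightarrow> elementary i j s \<in> S"
    and mult: "\<And>A B. A \<in> S \<Longrightarrow> B \<in> S \<Longrightarrow> A ** B \<in> S"
  shows "SL3 \<subseteq> S"
proof -
  have left: "A \<in> S" if "elementary i j s ** A \<in> S" "i \<noteq> j" for i j s A
  proof -
    have "elementary i j (- s) ** (elementary i j s ** A) = A"
      using that(2) by (simp add: matrix_mul_assoc elementary_0 flip: elementary_add)
    then show ?thesis using mult[OF el[OF that(2), of "- s"] that(1)] by simp
  qed
  have right: "A \<in> S" if "A ** elementary i j s \<in> S" "i \<noteq> j" for i j s A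
  proof -
    have "(A ** elementary i j s) ** elementary i j (- s) = A"
      using that(2) by (simp add: elementary_0 flip: elementary_add matrix_mul_assoc)
    then show ?thesis using mult[OF that(1) el[OF that(2), of "- s"]] by simp
  qed
  have det: "det (elementary i j s ** A) = det A" "det (A ** elementary i j s) = det A" if "i \<noteq> j" for i j s A
    using det_elementary[OF that] by (simp_all add: det_mul)
  note e = elementary_mult_left elementary_mult_right det
  \<comment> \<open>The cases run backwards through the elimination, each reducing to an earlier
    normal form. At the start the determinant forces the last diagonal entry to be 1; at the end it
    provides a nonzero entry in the first column.\<close>
  have c1: "A \<in> S" if A: "det A = 1" "A$1$1 = 1" "A$1$2 = 0" "A$1$3 = 0" "A$2$1 = 0" "A$3$1 = 0" "A$2$2 = 1" "A$3$2 = 0" for A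
  proof -
    have "A = elementary 2 3 (A$2$3)"
      using A by (simp add: det_3 vec_eq_iff forall_3 elementary_def)
    then show ?thesis using el[of 2 3 "A$2$3"] by simp
  qed
  have c2: "A \<in> S" if A: "det A = 1" "A$1$1 = 1" "A$1$2 = 0" "A$1$3 = 0" "A$2$1 = 0" "A$3$1 = 0" "A$2$2 = 1" for A
    by (rule left[of 3 2 "- A$3$2"], rule c1) (use A in \<open>simp_all add: e\<close>)
  have c3: "A \<in> S" if A: "det A = 1" "A$1$1 = 1" "A$1$2 = 0" "A$1$3 = 0" "A$2$1 = 0" "A$3$1 = 0" "A$3$2 \<noteq> 0" for A
    by (rule left[of 2 3 "(1 - A$2$2) / A$3$2"], rule c2) (use A in \<open>simp_all add: e\<close>)
  have c4: "A \<in> S" if A: "det A = 1" "A$1$1 = 1" "A$1$2 = 0" "A$1$3 = 0" "A$2$1 = 0" "A$3$1 = 0" for A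
  proof (cases "A$3$2 = 0")
    case True
    then have "A$2$2 \<noteq> 0" using A by (auto simp: det_3)
    with True show ?thesis
      by (intro left[of 3 2 1, OF c3]) (use A in \<open>simp_all add: e\<close>)
  qed (use c3 A in blast)
  have c5: "A \<in> S" if A: "det A = 1" "A$1$1 = 1" "A$2$1 = 0" "A$3$1 = 0" for A
    by (rule right[of _ 1 2 "- A$1$2"], simp_all, rule right[of _ 1 3 "- A$1$3"], simp_all, rule c4)
      (use A in \<open>simp_all add: e\<close>)
  have c6: "A \<in> S" if A: "det A = 1" "A$1$1 = 1" for A
    by (rule left[of 2 1 "- A$2$1"], simp_all, rule left[of 3 1 "- A$3$1"], simp_all, rule c5)
      (use A in \<open>simp_all add: e\<close>)
  have c7: "A \<in> S" if A: "det A = 1" "A$2$1 \<noteq> 0" for A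
    by (rule left[of 1 2 "(1 - A$1$1) / A$2$1"], rule c6) (use A in \<open>simp_all add: e\<close>)
  have c8: "A \<in> S" if A: "det A = 1" for A
  proof -
    have "A$2$1 \<noteq> 0 \<or> A$3$1 \<noteq> 0 \<or> A$1$1 \<noteq> 0"
      by (rule ccontr) (use A in \<open>simp add: det_3\<close>)
    then consider "A$2$1 \<noteq> 0" | "A$2$1 = 0" "A$3$1 \<noteq> 0" | "A$2$1 = 0" "A$3$1 = 0" "A$1$1 \<noteq> 0"
      by blast
    then show ?thesis
    proof cases
      case 1 then show ?thesis using A c7 by blast
    next
      case 2 then show ?thesis
        by (intro left[of 2 3 1, OF c7]) (use A in \<open>simp_all add: e\<close>)
    next
      case 3 then show ?thesis
        by (intro left[of 2 1 1, OF c7]) (use A in \<open>simp_all add: e\<close>)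
    qed
  qed
  show ?thesis using c8 by (auto simp: SL3_def)
qed

text \<open>\<open>z (s * t)\<close> is a commutator, that is, a product of four isometries whose
  displacements add up; opposite times displace equally.\<close>

lemma (in heisenberg_flows) commutator_displacement:
  "norm (z (s * t) p - p) \<le> 2 * norm (x s p - p) + 2 * norm (y t p - p)"
proof -
  define q where "q = x (- s) (y (- t) p)"
  have step: "norm (u r w - p) \<le> norm (u r p - p) + norm (w - p)" if "affine_flow u" for u r w
    using norm_triangle_ineq[of "u r w - u r p" "u r p - p"] affine_flowD(4)[OF that] by simp
  have "y t (x s q) = p"
    by (simp add: q_def affine_flowD[OF x] affine_flowD[OF y])
  then have "z (s * t) p = x s (y t q)" by (simp add: xy)
  then have "norm (z (s * t) p - p) \<le> norm (x s p - p) + (norm (y t p - p) + (norm (x (- s) p - p) + norm (y (- t) p - p)))"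
    unfolding q_def using step[OF x] step[OF y] by (smt (verit))
  then show ?thesis by (simp add: flow_displacement_minus[OF x] flow_displacement_minus[OF y])
qed

section \<open>Displacements under the six root subgroups\<close>

locale root_flows =
  fixes u :: "3 \<Rightarrow> 3 \<Rightarrow> real \<Rightarrow> 'a::real_normed_vector \<Rightarrow> 'a"
  assumes heis: "\<And>i j k. i \<noteq> j \<Longrightarrow> j \<noteq> k \<Longrightarrow> i \<noteq> k \<Longrightarrow> heisenberg_flows (u i j) (u j k) (u i k)"
begin

definition displacement_le :: "real \<Rightarrow> 'a \<Rightarrow> bool" where
  "displacement_le D p \<longleftrightarrow> (\<forall>i j s. i \<noteq> j \<longrightarrow> 0 \<le> s \<longrightarrow> s \<le> 1 \<longrightarrow> norm (u i j s p - p) \<le> D)"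

lemma third_index:
  fixes i k :: 3 assumes "i \<noteq> k"
  obtains j where "i \<noteq> j" "j \<noteq> k"
proof -
  have "\<exists>j. i \<noteq> j \<and> j \<noteq> k"
  proof (rule ccontr)
    assume "\<not> ?thesis"
    then have "\<forall>j. i = j \<or> j = k" by blast
    then show False using assms exhaust_3[of i] exhaust_3[of k] unfolding forall_3 by auto
  qed
  then show thesis using that by blast
qed

lemma flow: "i \<noteq> j \<Longrightarrow> affine_flow (u i j)"
  using third_index[of i j] heis heisenberg_flows.z by metis

text \<open>Root subgroups are exponentially distorted, as each of them consists of commutators; a
  polynomial bound in the logarithm is all that is needed.\<close>
lemma displacement_growth:
  assumes "displacement_le D p" "i \<noteq> j" "0 \<le> s" "s \<le> 2 ^ (2 ^ e)"
  shows "norm (u i j s p - p) \<le> 2 * 4 ^ e * D"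
  using assms(2-)
proof (induction e arbitrary: i j s)
  case 0
  \<comment> \<open>Here \<open>s\<close> is at most 2, so two steps of length at most 1
    suffice.\<close>
  have "norm (u i j (s / 2 + s / 2) p - p) \<le> norm (u i j (s / 2) p - p) + norm (u i j (s / 2) p - p)"
    by (rule flow_displacement_add[OF flow[OF 0(1)]])
  moreover have "norm (u i j (s / 2) p - p) \<le> D"
    using assms(1) 0 unfolding displacement_le_def by simp
  ultimately show ?case by simp
next
  case (Suc e)
  obtain k where k: "i \<noteq> k" "k \<noteq> j" using third_index[OF Suc.prems(1)] by metis
  interpret heisenberg_flows "u i k" "u k j" "u i j" by (rule heis[OF k Suc.prems(1)])
  \<comment> \<open>Squaring the range costs a factor 4: the element is a commutator of two elements
    with parameter \<open>sqrt s\<close>.\<close>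
  have "sqrt s \<le> sqrt ((2 ^ (2 ^ e))\<^sup>2)"
    using Suc.prems by (intro real_sqrt_le_mono) (simp add: power_mult[symmetric] mult.commute)
  then have s: "0 \<le> sqrt s" "sqrt s \<le> 2 ^ (2 ^ e)" using Suc.prems by simp_all
  have "norm (u i j (sqrt s * sqrt s) p - p) \<le> 2 * norm (u i k (sqrt s) p - p) + 2 * norm (u k j (sqrt s) p - p)"
    by (rule commutator_displacement)
  also have "\<dots> \<le> 2 * (2 * 4 ^ e * D) + 2 * (2 * 4 ^ e * D)"
    using Suc.IH[OF k(1) s] Suc.IH[OF k(2) s] by linarith
  also have "\<dots> = 2 * 4 ^ Suc e * D" by simp
  finally show ?case using Suc.prems by simp
qed

text \<open>Since the move is proportional to \<open>D\<close> with a constant independent of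
  \<open>p\<close>, iterating the halving gives geometrically small steps.\<close>

lemma displacement_contraction:
  assumes "uniformly_convex TYPE('a)"
  obtains C where "C > 0"
    "\<And>p D. D > 0 \<Longrightarrow> displacement_le D p \<Longrightarrow> \<exists>g. displacement_le (D / 2) g \<and> norm (g - p) \<le> C * D"
proof -
  obtain K where K: "K > 0"
    "\<And>x y z a \<Lambda> \<eta>. \<And>p::'a. heisenberg_flows x y z \<Longrightarrow> a \<ge> 4 \<Longrightarrow> \<eta> > 0 \<Longrightarrow>
      (\<And>s. 0 \<le> s \<Longrightarrow> s \<le> 2 ^ (8 * a) \<Longrightarrow> norm (x s p - p) \<le> \<Lambda>) \<Longrightarrow>
      (\<And>s. 0 \<le> s \<Longrightarrow> s \<le> 2 ^ (8 * a) \<Longrightarrow> norm (y s p - p) \<le> \<Lambda>) \<Longrightarrow>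
      (\<And>s. 0 \<le> s \<Longrightarrow> s \<le> 2 ^ (8 * a) \<Longrightarrow> norm (z s p - p) \<le> \<Lambda>) \<Longrightarrow>
      \<exists>m0. \<forall>m\<ge>m0. \<forall>s. 0 \<le> s \<and> s \<le> 2 ^ (2 * a) \<longrightarrow>
        (let q = averaging x (dyadic m (m + 4 * a)) (averaging y (dyadic m (m + 4 * a)) p) in
          norm (x s q - q) \<le> K / real a ^ 3 * \<Lambda> + \<eta> \<and> norm (y s q - q) \<le> K / real a ^ 3 * \<Lambda> + \<eta> \<and>
          norm (z s q - q) \<le> K / real a ^ 3 * \<Lambda> + \<eta>)"
    using heisenberg_averaging[OF assms] by blast
  \<comment> \<open>At the end \<open>4 * \<epsilon>\<close> is
    \<open>10752 * (K / b) * D + 12 * \<eta>\<close>. The bound \<open>43008 = 4 * 10752\<close>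
    makes the first term at most \<open>D / 4\<close>, and \<open>\<eta> = D / 48\<close> does so
    for the second.\<close>
  obtain e where "max 4 (43008 * K) < 2 ^ e" using real_arch_pow[of 2 "max 4 (43008 * K)"] by auto
  then have e: "4 < (2::real) ^ e" "43008 * K < 2 ^ e" by auto
  define b :: nat where "b = 2 ^ e"
  have b: "b \<ge> 4" "real b > 43008 * K" "b > 0"
  proof -
    have "real 4 < real b" using e(1) by (simp add: b_def)
    then show "b \<ge> 4" "b > 0" by auto
  qed (use e(2) in \<open>simp add: b_def\<close>)
  have bp: "16 * b = 2 ^ (e + 4)" by (simp add: b_def power_add)
  define L where "L = 512 * real b ^ 2"
  have L: "L = 2 * 4 ^ (e + 4)"
    by (simp add: L_def b_def power_add power2_eq_square flip: power_mult_distrib)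
  have L0: "L > 0" using b by (simp add: L_def)
  show thesis
  proof (rule that[of "7 * L"])
    fix p D assume D: "D > 0" and p: "displacement_le D p"
    define \<eta> where "\<eta> = D / 48"
    have \<eta>: "\<eta> > 0" using D by (simp add: \<eta>_def)
    have grow: "norm (u i j s p - p) \<le> L * D" if "i \<noteq> j" "0 \<le> s" "s \<le> 2 ^ (16 * b)" for i j s
      using displacement_growth[OF p that(1,2), of "e + 4"] that(3) unfolding bp L by simp
    have pow: "s \<le> 2 ^ j" if "s \<le> 2 ^ i" "i \<le> j" for i j :: nat and s :: real
      using that by (meson order_trans power_increasing one_le_numeral)
    \<comment> \<open>These groups have their centers at every second vertex of the hexagon, 13, 21
      and 32, and share the roots 12, 23, 31. The last one is flipped so that the average over 12
      acts last.\<close>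
    have h2: "heisenberg_flows (u 1 2) (u 2 3) (u 1 3)"
      and h4: "heisenberg_flows (u 2 3) (u 3 1) (u 2 1)"
      and h6: "heisenberg_flows (u 1 2) (u 3 1) (\<lambda>r. u 3 2 (- r))"
      using heis[of 1 2 3] heis[of 2 3 1] heisenberg_flows.flipped[OF heis[of 3 1 2]] by simp_all
    \<comment> \<open>The first averaging uses the parameter \<open>2 * b\<close>, so that
      \<open>f\<close> is almost invariant up to \<open>2 ^ (4 * b)\<close>, the range of the second
      averages with parameter \<open>b\<close>. The factor 5 in \<open>\<epsilon>2\<close> accounts
      for the move from \<open>p\<close> to \<open>f\<close>.\<close>
    define \<epsilon>1 where "\<epsilon>1 = K / real (2 * b) ^ 3 * (L * D) + \<eta>"
    define \<epsilon>2 where "\<epsilon>2 = K / real b ^ 3 * (5 * L * D) + \<eta>"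
    have "\<exists>m0. \<forall>m\<ge>m0. \<forall>s. 0 \<le> s \<and> s \<le> 2 ^ (2 * (2 * b)) \<longrightarrow>
        (let q = averaging (u 2 3) (dyadic m (m + 4 * (2 * b))) (averaging (u 3 1) (dyadic m (m + 4 * (2 * b))) p) in
          norm (u 2 3 s q - q) \<le> \<epsilon>1 \<and> norm (u 3 1 s q - q) \<le> \<epsilon>1 \<and> norm (u 2 1 s q - q) \<le> \<epsilon>1)"
      unfolding \<epsilon>1_def by (rule K(2)[OF h4 _ \<eta>]) (use b grow in auto)
    then obtain m1 where m1: "\<forall>s. 0 \<le> s \<and> s \<le> 2 ^ (2 * (2 * b)) \<longrightarrow>
        (let q = averaging (u 2 3) (dyadic m1 (m1 + 4 * (2 * b))) (averaging (u 3 1) (dyadic m1 (m1 + 4 * (2 * b))) p) in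
          norm (u 2 3 s q - q) \<le> \<epsilon>1 \<and> norm (u 3 1 s q - q) \<le> \<epsilon>1 \<and> norm (u 2 1 s q - q) \<le> \<epsilon>1)"
      by blast
    define f where "f = averaging (u 2 3) (dyadic m1 (m1 + 4 * (2 * b))) (averaging (u 3 1) (dyadic m1 (m1 + 4 * (2 * b))) p)"
    have f: "norm (u 2 3 s f - f) \<le> \<epsilon>1" "norm (u 3 1 s f - f) \<le> \<epsilon>1" if "0 \<le> s" "s \<le> 2 ^ (4 * b)" for s
      using m1[rule_format, of s] that by (auto simp: f_def Let_def)
    have av: "norm (averaging (u i j) (dyadic m (m + 4 * (2 * b))) p - p) \<le> L * D" if "i \<noteq> j" for i j m
      by (rule dyadic_averaging_displacement_le[OF flow[OF that]]) (use grow[OF that] pow in auto)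
    have fp: "norm (f - p) \<le> 2 * L * D"
    proof -
      have "norm (f - averaging (u 2 3) (dyadic m1 (m1 + 4 * (2 * b))) p) \<le> L * D"
        unfolding f_def by (rule order_trans[OF averaging_nonexp[OF flow] av]) auto
      then show ?thesis
        using av[of 2 3 m1] norm_triangle_ineq[of "f - averaging (u 2 3) (dyadic m1 (m1 + 4 * (2 * b))) p"
            "averaging (u 2 3) (dyadic m1 (m1 + 4 * (2 * b))) p - p"] by simp
    qed
    have tri: "norm (T a - a) \<le> norm (T c - c) + 2 * norm (a - c)" if "affine_isometry T" for T and a c :: 'a
    proof -
      have "T a - a = (T a - T c) + (T c - c) - (a - c)" by simp
      then have "norm (T a - a) \<le> norm (T a - T c) + norm (T c - c) + norm (a - c)"
        by (smt (verit) norm_triangle_ineq norm_triangle_ineq4)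
      then show ?thesis using affine_isometry_dist[OF that] by simp
    qed
    have fgrow: "norm (u i j s f - f) \<le> 5 * L * D" if "i \<noteq> j" "0 \<le> s" "s \<le> 2 ^ (8 * b)" for i j s
      using tri[OF affine_flowD(1)[OF flow[OF that(1)]], of s f p] fp grow[OF that(1,2) pow[OF that(3)]] by simp
    have "\<exists>m0. \<forall>m\<ge>m0. \<forall>s. 0 \<le> s \<and> s \<le> 2 ^ (2 * b) \<longrightarrow>
        (let q = averaging (u 1 2) (dyadic m (m + 4 * b)) (averaging (u 2 3) (dyadic m (m + 4 * b)) f) in
          norm (u 1 2 s q - q) \<le> \<epsilon>2 \<and> norm (u 2 3 s q - q) \<le> \<epsilon>2 \<and> norm (u 1 3 s q - q) \<le> \<epsilon>2)"
      unfolding \<epsilon>2_def by (rule K(2)[OF h2 b(1) \<eta>]) (use fgrow in auto)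
    then obtain m2 where m2: "\<forall>m\<ge>m2. \<forall>s. 0 \<le> s \<and> s \<le> 2 ^ (2 * b) \<longrightarrow>
        (let q = averaging (u 1 2) (dyadic m (m + 4 * b)) (averaging (u 2 3) (dyadic m (m + 4 * b)) f) in
          norm (u 1 2 s q - q) \<le> \<epsilon>2 \<and> norm (u 2 3 s q - q) \<le> \<epsilon>2 \<and> norm (u 1 3 s q - q) \<le> \<epsilon>2)" ..
    have "\<exists>m0. \<forall>m\<ge>m0. \<forall>s. 0 \<le> s \<and> s \<le> 2 ^ (2 * b) \<longrightarrow>
        (let q = averaging (u 1 2) (dyadic m (m + 4 * b)) (averaging (u 3 1) (dyadic m (m + 4 * b)) f) in
          norm (u 1 2 s q - q) \<le> \<epsilon>2 \<and> norm (u 3 1 s q - q) \<le> \<epsilon>2 \<and> norm (u 3 2 (- s) q - q) \<le> \<epsilon>2)"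
      unfolding \<epsilon>2_def by (rule K(2)[OF h6 b(1) \<eta>]) (use fgrow in \<open>auto simp: flow_displacement_minus[OF flow]\<close>)
    then obtain m6 where m6: "\<forall>m\<ge>m6. \<forall>s. 0 \<le> s \<and> s \<le> 2 ^ (2 * b) \<longrightarrow>
        (let q = averaging (u 1 2) (dyadic m (m + 4 * b)) (averaging (u 3 1) (dyadic m (m + 4 * b)) f) in
          norm (u 1 2 s q - q) \<le> \<epsilon>2 \<and> norm (u 3 1 s q - q) \<le> \<epsilon>2 \<and> norm (u 3 2 (- s) q - q) \<le> \<epsilon>2)" ..
    define m where "m = max m2 m6"
    define g where "g = averaging (u 1 2) (dyadic m (m + 4 * b)) f"
    define q2 where "q2 = averaging (u 1 2) (dyadic m (m + 4 * b)) (averaging (u 2 3) (dyadic m (m + 4 * b)) f)"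
    define q6 where "q6 = averaging (u 1 2) (dyadic m (m + 4 * b)) (averaging (u 3 1) (dyadic m (m + 4 * b)) f)"
    \<comment> \<open>As \<open>f\<close> is almost invariant under 23, including or omitting the
      average over 23 changes little, and the outer average is nonexpansive; likewise for 31
      below.\<close>
    have gq2: "norm (g - q2) \<le> \<epsilon>1"
      unfolding g_def q2_def norm_minus_commute[of "averaging (u 1 2) (dyadic m (m + 4 * b)) f"]
      by (rule order_trans[OF averaging_nonexp[OF flow] dyadic_averaging_displacement_le[OF flow f(1)]]) auto
    have gq6: "norm (g - q6) \<le> \<epsilon>1"
      unfolding g_def q6_def norm_minus_commute[of "averaging (u 1 2) (dyadic m (m + 4 * b)) f"]
      by (rule order_trans[OF averaging_nonexp[OF flow] dyadic_averaging_displacement_le[OF flow f(2)]]) auto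
    define \<epsilon> where "\<epsilon> = \<epsilon>2 + 2 * \<epsilon>1"
    have near: "norm (u i j s g - g) \<le> \<epsilon>"
      if "i \<noteq> j" "norm (u i j s q - q) \<le> \<epsilon>2" "norm (g - q) \<le> \<epsilon>1" for i j s q
      using tri[OF affine_flowD(1)[OF flow[OF that(1)]], of s g q] that by (simp add: \<epsilon>_def)
    have inv: "norm (u 1 2 s g - g) \<le> \<epsilon>" "norm (u 2 3 s g - g) \<le> \<epsilon>" "norm (u 1 3 s g - g) \<le> \<epsilon>"
      "norm (u 3 1 s g - g) \<le> \<epsilon>" "norm (u 3 2 s g - g) \<le> \<epsilon>" if s: "0 \<le> s" "s \<le> 1" for s
    proof -
      have s': "0 \<le> s \<and> s \<le> 2 ^ (2 * b)" using s pow[of s 0 "2 * b"] by simp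
      have 2: "norm (u 1 2 s q2 - q2) \<le> \<epsilon>2 \<and> norm (u 2 3 s q2 - q2) \<le> \<epsilon>2 \<and> norm (u 1 3 s q2 - q2) \<le> \<epsilon>2"
        using m2[rule_format, OF _ s', of m] by (simp add: m_def q2_def Let_def)
      have 6: "norm (u 1 2 s q6 - q6) \<le> \<epsilon>2 \<and> norm (u 3 1 s q6 - q6) \<le> \<epsilon>2 \<and> norm (u 3 2 s q6 - q6) \<le> \<epsilon>2"
        using m6[rule_format, OF _ s', of m] flow_displacement_minus[OF flow[of 3 2]]
        by (simp add: m_def q6_def Let_def)
      show "norm (u 1 2 s g - g) \<le> \<epsilon>" "norm (u 2 3 s g - g) \<le> \<epsilon>" "norm (u 1 3 s g - g) \<le> \<epsilon>"
        using 2 by (auto intro!: near[OF _ _ gq2])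
      show "norm (u 3 1 s g - g) \<le> \<epsilon>" "norm (u 3 2 s g - g) \<le> \<epsilon>"
        using 6 by (auto intro!: near[OF _ _ gq6])
    qed
    \<comment> \<open>The remaining root 21 is the commutator of 23 and 31, at the cost of a factor
      4.\<close>
    have inv4: "norm (u 2 1 s g - g) \<le> 4 * \<epsilon>" if s: "0 \<le> s" "s \<le> 1" for s
      using heisenberg_flows.commutator_displacement[OF h4, of s 1 g] inv(2)[OF s] inv(4)[of 1] by simp
    have "\<epsilon> \<ge> 0" using order_trans[OF norm_ge_zero inv(1)[of 0]] by simp
    moreover have "4 * \<epsilon> \<le> D / 2"
    proof -
      have b3: "real b ^ 3 = real b * real b ^ 2" by (simp add: power2_eq_square power3_eq_cube)
      have r: "real b > 0" using b by simp
      have "\<epsilon>1 = 64 * (K / real b) * D + \<eta>"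
        using r by (simp add: \<epsilon>1_def L_def power_mult_distrib b3)
      moreover have "\<epsilon>2 = 2560 * (K / real b) * D + \<eta>"
        using r by (simp add: \<epsilon>2_def L_def b3)
      ultimately have "4 * \<epsilon> = 10752 * (K / real b) * D + 12 * \<eta>" by (simp add: \<epsilon>_def)
      also have "10752 * (K / real b) \<le> 1 / 4" using b(2) r by (simp add: field_simps)
      then have "10752 * (K / real b) * D \<le> 1 / 4 * D" using D by (intro mult_right_mono) auto
      finally show ?thesis by (simp add: \<eta>_def)
    qed
    ultimately have e4: "\<epsilon> \<le> D / 2" "4 * \<epsilon> \<le> D / 2" by auto
    have "displacement_le (D / 2) g"
      unfolding displacement_le_def
    proof (intro allI impI)
      fix i j :: 3 and s :: real assume "i \<noteq> j" "0 \<le> s" "s \<le> 1"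
      then show "norm (u i j s g - g) \<le> D / 2"
        using exhaust_3[of i] exhaust_3[of j] order_trans[OF inv(1) e4(1)] order_trans[OF inv(2) e4(1)]
          order_trans[OF inv(3) e4(1)] order_trans[OF inv(4) e4(1)] order_trans[OF inv(5) e4(1)]
          order_trans[OF inv4 e4(2)] by auto
    qed
    moreover have "norm (g - p) \<le> 7 * L * D"
    proof -
      have "norm (g - f) \<le> 5 * L * D" unfolding g_def
        by (rule dyadic_averaging_displacement_le[OF flow]) (use fgrow pow in auto)
      then show ?thesis using fp norm_triangle_ineq[of "g - f" "f - p"] by simp
    qed
    ultimately show "\<exists>g. displacement_le (D / 2) g \<and> norm (g - p) \<le> 7 * L * D" by blast
  qed (use L0 in simp)
qed

end

context root_flows
begin

text \<open>Continuity at 0 bounds the displacement for short times, and a time up to 1 is a bounded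
  multiple of a short one.\<close>

lemma displacement_bounded:
  obtains D where "D > 0" "displacement_le D p"
proof -
  have "\<exists>D. i \<noteq> j \<longrightarrow> (\<forall>s. 0 \<le> s \<and> s \<le> 1 \<longrightarrow> norm (u i j s p - p) \<le> D)" for i j
  proof (cases "i = j")
    case False
    obtain r0 where r0: "r0 > 0" "\<And>r. \<bar>r\<bar> \<le> r0 \<Longrightarrow> norm (u i j r p - p) \<le> 1"
      using affine_flow_small[OF flow[OF False], of 1 p] by auto
    obtain n :: nat where n: "n > 0" "inverse (real n) < r0" using ex_inverse_of_nat_less[OF r0(1)] by auto
    have "norm (u i j s p - p) \<le> real n" if s: "0 \<le> s" "s \<le> 1" for s
    proof -
      have "s / real n \<le> inverse (real n)" using s n by (simp add: divide_inverse mult_left_le_one_le)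
      then have "norm (u i j (s / real n) p - p) \<le> 1" using s n by (intro r0(2)) simp
      from mult_left_mono[OF this, of "real n"]
      have "real n * norm (u i j (s / real n) p - p) \<le> real n" by simp
      moreover have "norm (u i j s p - p) \<le> real n * norm (u i j (s / real n) p - p)"
        using flow_displacement_mult[OF flow[OF False], of n "s / real n" p] n by simp
      ultimately show ?thesis by (rule order_trans[rotated])
    qed
    then show ?thesis by blast
  qed simp
  then obtain B where B: "\<And>i j s. i \<noteq> j \<Longrightarrow> 0 \<le> s \<Longrightarrow> s \<le> 1 \<Longrightarrow> norm (u i j s p - p) \<le> B i j" by metis
  define D where "D = 1 + (\<Sum>i\<in>UNIV. \<Sum>j\<in>UNIV. \<bar>B i j\<bar>)"
  have "B i j \<le> D" for i j
  proof -
    have "\<bar>B i j\<bar> \<le> (\<Sum>j\<in>UNIV. \<bar>B i j\<bar>)" by (rule member_le_sum) auto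
    also have "\<dots> \<le> (\<Sum>i\<in>UNIV. \<Sum>j\<in>UNIV. \<bar>B i j\<bar>)"
      by (rule member_le_sum[of i UNIV "\<lambda>i. \<Sum>j\<in>UNIV. \<bar>B i j\<bar>"]) (auto intro: sum_nonneg)
    finally show ?thesis by (simp add: D_def)
  qed
  then have "displacement_le D p" unfolding displacement_le_def using B order_trans by blast
  moreover have "D > 0" unfolding D_def by (intro add_pos_nonneg sum_nonneg) auto
  ultimately show thesis by (rule that[rotated])
qed

end

section \<open>Convergence of the iteration and the fixed point\<close>

lemma Cauchy_geometric:
  fixes p :: "nat \<Rightarrow> 'a::banach"
  assumes "\<And>n. norm (p (Suc n) - p n) \<le> C / 2 ^ n"
  obtains q where "p \<longlonglongrightarrow> q"
proof -
  have "summable (\<lambda>n. C * (1 / 2) ^ n)" by (intro summable_mult summable_geometric) auto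
  then have "summable (\<lambda>n. p (Suc n) - p n)"
    by (rule summable_comparison_test'[where N = 0]) (use assms in \<open>simp add: power_one_over\<close>)
  then have "convergent (\<lambda>n. \<Sum>k<n. p (Suc k) - p k)" by (simp add: summable_iff_convergent)
  then obtain l where "(\<lambda>n. p n - p 0) \<longlonglongrightarrow> l"
    by (auto simp: sum_lessThan_telescope convergent_def)
  from tendsto_add[OF this tendsto_const[of "p 0"]] show thesis by (intro that) simp
qed

lemma root_flows_fixed_point:
  fixes u :: "3 \<Rightarrow> 3 \<Rightarrow> real \<Rightarrow> 'a::banach \<Rightarrow> 'a"
  assumes "root_flows u" "uniformly_convex TYPE('a)"
  shows "\<exists>q. \<forall>i j s. i \<noteq> j \<longrightarrow> u i j s q = q"
proof -
  interpret root_flows u by fact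
  obtain C where C: "C > 0"
    "\<And>p D. D > 0 \<Longrightarrow> displacement_le D p \<Longrightarrow> \<exists>g. displacement_le (D / 2) g \<and> norm (g - p) \<le> C * D"
    using displacement_contraction[OF assms(2)] by blast
  obtain D where D: "D > 0" "displacement_le D 0" using displacement_bounded by blast
  have "\<exists>p. \<forall>n. displacement_le (D / 2 ^ n) (p n) \<and> norm (p (Suc n) - p n) \<le> C * (D / 2 ^ n)"
  proof (rule dependent_nat_choice)
    show "\<exists>x. displacement_le (D / 2 ^ 0) x" using D by auto
    fix x n assume "displacement_le (D / 2 ^ n) x"
    with C(2)[of "D / 2 ^ n" x] D(1)
    show "\<exists>y. displacement_le (D / 2 ^ Suc n) y \<and> norm (y - x) \<le> C * (D / 2 ^ n)"
      by (simp add: mult.commute)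
  qed
  then obtain p where p: "\<And>n. displacement_le (D / 2 ^ n) (p n)"
    "\<And>n. norm (p (Suc n) - p n) \<le> C * (D / 2 ^ n)" by blast
  obtain q where q: "p \<longlonglongrightarrow> q"
    using Cauchy_geometric[of p "C * D"] p(2) by auto
  have small: "u i j s q = q" if ij: "i \<noteq> j" and s: "0 \<le> s" "s \<le> 1" for i j s
  proof -
    \<comment> \<open>Isometry transfers the vanishing displacements of \<open>p n\<close> to the
      limit.\<close>
    have "norm (u i j s q - q) \<le> 2 * norm (q - p n) + D * (1 / 2) ^ n" for n
    proof -
      have "norm (u i j s q - q) \<le> norm (u i j s q - u i j s (p n)) + norm (u i j s (p n) - p n) + norm (q - p n)"
        using norm_triangle_ineq[of "u i j s q - u i j s (p n)" "u i j s (p n) - p n"]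
          norm_triangle_ineq4[of "(u i j s q - u i j s (p n)) + (u i j s (p n) - p n)" "q - p n"] by simp
      also have "norm (u i j s (p n) - p n) \<le> D * (1 / 2) ^ n"
        using p(1)[of n] ij s by (simp add: displacement_le_def power_one_over)
      finally show ?thesis by (simp add: affine_flowD(4)[OF flow[OF ij]])
    qed
    moreover have "(\<lambda>n. 2 * norm (q - p n) + D * (1 / 2) ^ n) \<longlonglongrightarrow> 2 * norm (q - q) + D * 0"
      by (intro tendsto_intros q LIMSEQ_power_zero) auto
    ultimately have "norm (u i j s q - q) \<le> 2 * norm (q - q) + D * 0"
      by (intro LIMSEQ_le_const) auto
    then show ?thesis by simp
  qed
  \<comment> \<open>Arbitrary times follow from those in the unit interval by subdivision and
    inversion.\<close>
  have "u i j s q = q" if ij: "i \<noteq> j" for i j s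
  proof -
    obtain n :: nat where n: "\<bar>s\<bar> < real n" using reals_Archimedean2 by blast
    then have "u i j (\<bar>s\<bar> / real n) q = q" by (intro small[OF ij]) auto
    then have "norm (u i j \<bar>s\<bar> q - q) \<le> 0"
      using flow_displacement_mult[OF flow[OF ij], of n "\<bar>s\<bar> / real n" q] n by simp
    then have "norm (u i j s q - q) \<le> 0"
      using flow_displacement_minus[OF flow[OF ij], of s q] by (cases "s \<ge> 0") auto
    then show ?thesis by simp
  qed
  then show ?thesis by blast
qed

text \<open>Uniform convexity makes the isometries affine, and the Heisenberg relations are matrix
  identities carried over by the action.\<close>

lemma SL3_action_root_flows:
  fixes \<alpha> :: "real^3^3 \<Rightarrow> 'a::real_normed_vector \<Rightarrow> 'a"
  assumes uc: "uniformly_convex TYPE('a)" and act: "continuous_isometric_SL3_action \<alpha>"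
  shows "root_flows (\<lambda>i j s. \<alpha> (elementary i j s))"
proof -
  have one: "\<alpha> (mat 1) p = p" for p
    using act by (simp add: continuous_isometric_SL3_action_def)
  have mult: "\<alpha> (A ** B) p = \<alpha> A (\<alpha> B p)" if "A \<in> SL3" "B \<in> SL3" for A B p
    using act that by (simp add: continuous_isometric_SL3_action_def)
  have iso: "dist (\<alpha> A p) (\<alpha> A q) = dist p q" if "A \<in> SL3" for A p q
    using act that by (simp add: continuous_isometric_SL3_action_def)
  have cont: "continuous_on (SL3 \<times> UNIV) (\<lambda>(A, p). \<alpha> A p)"
    using act by (simp add: continuous_isometric_SL3_action_def)
  have flow: "affine_flow (\<lambda>s. \<alpha> (elementary i j s))" if ij: "i \<noteq> j" for i j
    unfolding affine_flow_def
  proof (intro conjI allI)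
    show "affine_isometry (\<alpha> (elementary i j s))" for s
      by (rule isometry_imp_affine_isometry[OF uc iso[OF elementary_SL3[OF ij]]])
    show "\<alpha> (elementary i j 0) p = p" for p by (simp add: elementary_0 one)
    show "\<alpha> (elementary i j (s + t)) p = \<alpha> (elementary i j s) (\<alpha> (elementary i j t) p)" for s t p
      by (simp add: elementary_add[OF ij] mult elementary_SL3[OF ij])
    fix p :: 'a
    have "continuous_on UNIV (\<lambda>s. if k = l then 1 else if k = i \<and> l = j then s else (0::real))" for k l :: 3
      by (cases "k = l"; cases "k = i \<and> l = j") auto
    then have "continuous_on UNIV (\<lambda>s. (elementary i j s, p))"
      unfolding elementary_def by (intro continuous_on_Pair continuous_on_vec_lambda continuous_on_const)
    from continuous_on_compose2[OF cont this]
    have "continuous_on UNIV (\<lambda>s. \<alpha> (elementary i j s) p)"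
      using elementary_SL3[OF ij] by auto
    then show "isCont (\<lambda>s. \<alpha> (elementary i j s) p) 0"
      by (simp add: continuous_on_eq_continuous_at)
  qed
  show ?thesis
  proof (rule root_flows.intro)
    fix i j k :: 3 assume d: "i \<noteq> j" "j \<noteq> k" "i \<noteq> k"
    note in_SL3 = elementary_SL3[OF d(1)] elementary_SL3[OF d(2)] elementary_SL3[OF d(3)]
    have SL3_mult: "A ** B \<in> SL3" if "A \<in> SL3" "B \<in> SL3" for A B
      using that by (simp add: SL3_def det_mul)
    show "heisenberg_flows (\<lambda>s. \<alpha> (elementary i j s)) (\<lambda>s. \<alpha> (elementary j k s)) (\<lambda>s. \<alpha> (elementary i k s))"
    proof
      fix r s t and q
      show "\<alpha> (elementary i k r) (\<alpha> (elementary i j s) q) = \<alpha> (elementary i j s) (\<alpha> (elementary i k r) q)"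
        using elementary_commute[of i k i j r s] d by (simp add: in_SL3 flip: mult)
      show "\<alpha> (elementary i k r) (\<alpha> (elementary j k s) q) = \<alpha> (elementary j k s) (\<alpha> (elementary i k r) q)"
        using elementary_commute[of i k j k r s] d by (simp add: in_SL3 flip: mult)
      show "\<alpha> (elementary i j s) (\<alpha> (elementary j k t) q)
          = \<alpha> (elementary i k (s * t)) (\<alpha> (elementary j k t) (\<alpha> (elementary i j s) q))"
        using elementary_commutator[OF d, of s t] by (simp add: in_SL3 SL3_mult flip: mult)
    qed (use flow d in auto)
  qed
qed

theorem theorem4p6:
  fixes \<alpha> :: "real^3^3 \<Rightarrow> 'a::banach \<Rightarrow> 'a"
  assumes "uniformly_convex TYPE('a)"
    and "continuous_isometric_SL3_action \<alpha>"
  shows "\<exists>x. \<forall>A\<in>SL3. \<alpha> A x = x"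
proof -
  obtain q where q: "\<And>i j s. i \<noteq> j \<Longrightarrow> \<alpha> (elementary i j s) q = q"
    using root_flows_fixed_point[OF SL3_action_root_flows[OF assms] assms(1)] by blast
  \<comment> \<open>The stabiliser of \<open>q\<close> is taken inside \<open>SL3\<close>, where the
    action law holds.\<close>
  have "SL3 \<subseteq> {A \<in> SL3. \<alpha> A q = q}"
  proof (rule SL3_generated)
    fix A B assume "A \<in> {A \<in> SL3. \<alpha> A q = q}" "B \<in> {A \<in> SL3. \<alpha> A q = q}"
    then show "A ** B \<in> {A \<in> SL3. \<alpha> A q = q}"
      using assms(2) by (simp add: continuous_isometric_SL3_action_def SL3_def det_mul)
  qed (use q elementary_SL3 in auto)
  then show ?thesis by blast
qed

end
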